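(* Let $m,d\ge1$, $T>0$ and $X_0\in\mathbb{R}^m$ be fixed. Let $f:\mathbb{R}^m\to\mathbb{R}^m$ and $g:\mathbb{R}^m\to\mathbb{R}^{m\times d}$ be locally Lipschitz, i.e. for every $R>0$ there is a constant $C_R$ with $$\|f(x)-f(y)\|+\|g(x)-g(y)\|\le C_R\|x-y\|\quad\text{for all }x,y\in\mathbb{R}^m\text{ with }\|x\|,\|y\|\le R,$$ and suppose there exist constants $\alpha,\beta\ge0$ such that for all $x\in\mathbb{R}^m$ $$\langle x,f(x)\rangle\le\alpha\|x\|^2+\beta,\qquad \|g(x)\|^2\le\alpha\|x\|^2+\beta .$$ Let $h:\mathbb{R}^m\to(0,\infty)$ be continuous and strictly positive, and suppose there exist constants $\alpha',\beta'>0$ and $\xi,\zeta,q>0$ such that for all $x\in\mathbb{R}^m$ $$\langle x,f(x)\rangle+\tfrac12h(x)\|f(x)\|^2\le\alpha'\|x\|^2+\beta'\qquad\text{and}\qquad h(x)\ge\left(\xi\|x\|^q+\zeta\right)^{-1}.$$ Let $(t_n)_{n\ge0}$ be the time points of the adaptive Euler-Maruyama scheme with timestep function $h$ and initial value $X_0$ (defined in the context), and let $N_T=\min\{n:t_n\ge T\}$ be the number of timesteps required by a path approximation. Then for all $p>0$ $$\mathbb{E}\left[N_T^p\right]<\infty .$$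
   Context: $W$ is a standard $d$-dimensional Brownian motion on a probability space $(\Omega,\mathcal F,\mathbb P)$ with corresponding normal filtration $(\mathcal F_t)$. $\|\cdot\|$ is the Euclidean norm on vectors and the Frobenius norm on matrices; $\langle\cdot,\cdot\rangle$ is the Euclidean inner product. The underlying SDE is $dX_t=f(X_t)\,dt+g(X_t)\,dW_t$ with fixed (deterministic) initial value $X_0$. Adaptive Euler-Maruyama scheme with timestep function $h$: $t_0=0$, $\widehat X_0=X_0$, and for $n\ge0$ $$h_n=h(\widehat X_{t_n}),\quad t_{n+1}=t_n+h_n,\quad \widehat X_{t_{n+1}}=\widehat X_{t_n}+f(\widehat X_{t_n})h_n+g(\widehat X_{t_n})\Delta W_n,\quad \Delta W_n=W_{t_{n+1}}-W_{t_n}.$$ By convention $N_T=\infty$ if no $t_n\ge T$ exists. *)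

theory Defs
  imports "HOL-Probability.Probability"
begin

text \<open>Time is a real number; \<open>F t\<close> and \<open>W t\<close> are only constrained for \<open>t \<ge> 0\<close>.\<close>

definition normal_filtration :: "'a measure \<Rightarrow> (real \<Rightarrow> 'a measure) \<Rightarrow> bool" where
  "normal_filtration M F \<longleftrightarrow>
     (\<forall>t\<ge>0. subalgebra M (F t)) \<and>
     (\<forall>s t. 0 \<le> s \<longrightarrow> s \<le> t \<longrightarrow> sets (F s) \<subseteq> sets (F t)) \<and>
     null_sets M \<subseteq> sets (F 0) \<and>
     (\<forall>t\<ge>0. (\<Inter>s\<in>{t<..}. sets (F s)) = sets (F t))"

text \<open>
  The density in the last clause is that of \<open>N(0, (t - s) I)\<close>: a product over the
  coordinates of one-dimensional normal densities, whose second parameter in the library is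
  the standard deviation. As \<open>M\<close> is not assumed complete, the path properties are
  \<open>AE\<close> statements, i.e. they hold outside a set contained in a measurable null set;
  functionals of the path such as the number of timesteps below are then measurable with respect
  to the completion of \<open>M\<close> only.
\<close>

definition brownian_motion ::
    "'a measure \<Rightarrow> (real \<Rightarrow> 'a measure) \<Rightarrow> (real \<Rightarrow> 'a \<Rightarrow> real ^ 'd) \<Rightarrow> bool" where
  "brownian_motion M F W \<longleftrightarrow>
     (\<forall>t\<ge>0. W t \<in> borel_measurable (F t)) \<and>
     (AE \<omega> in M. W 0 \<omega> = 0) \<and>
     (AE \<omega> in M. continuous_on {0..} (\<lambda>t. W t \<omega>)) \<and>
     (\<forall>s t. 0 \<le> s \<longrightarrow> s < t \<longrightarrow>
        prob_space.indep_set M (sets (F s))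
          {(\<lambda>\<omega>. W t \<omega> - W s \<omega>) -` A \<inter> space M | A. A \<in> sets borel}) \<and>
     (\<forall>s t. 0 \<le> s \<longrightarrow> s < t \<longrightarrow>
        distributed M lborel (\<lambda>\<omega>. W t \<omega> - W s \<omega>)
          (\<lambda>x. ennreal (\<Prod>i\<in>UNIV. normal_density 0 (sqrt (t - s)) (x $ i))))"

text \<open>
  Vectors with \<open>m\<close> entries and \<open>m \<times> d\<close> matrices are \<open>real ^ 'm\<close> and
  \<open>real ^ 'd ^ 'm\<close> (row index outermost); the library norm on the latter, the Euclidean
  norm of the Euclidean norms of the rows, is the Frobenius norm.
\<close>

definition locally_lipschitz_coeffs ::
    "(real ^ 'm \<Rightarrow> real ^ 'm) \<Rightarrow> (real ^ 'm \<Rightarrow> real ^ 'd ^ 'm) \<Rightarrow> bool" where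
  "locally_lipschitz_coeffs f g \<longleftrightarrow>
     (\<forall>R>0. \<exists>C. \<forall>x y. norm x \<le> R \<longrightarrow> norm y \<le> R \<longrightarrow>
        norm (f x - f y) + norm (g x - g y) \<le> C * norm (x - y))"

text \<open>
  The pair of the \<open>n\<close>-th time point and the approximation there, along a single
  driving path \<open>w\<close>.
\<close>

primrec adaptive_em ::
    "(real ^ 'm \<Rightarrow> real ^ 'm) \<Rightarrow> (real ^ 'm \<Rightarrow> real ^ 'd ^ 'm) \<Rightarrow> (real ^ 'm \<Rightarrow> real) \<Rightarrow>
     real ^ 'm \<Rightarrow> (real \<Rightarrow> real ^ 'd) \<Rightarrow> nat \<Rightarrow> real \<times> (real ^ 'm)" where
  "adaptive_em f g h X0 w 0 = (0, X0)"
| "adaptive_em f g h X0 w (Suc n) =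
     (let (t, x) = adaptive_em f g h X0 w n; t' = t + h x
      in (t', x + h x *\<^sub>R f x + g x *v (w t' - w t)))"

definition em_time ::
    "(real ^ 'm \<Rightarrow> real ^ 'm) \<Rightarrow> (real ^ 'm \<Rightarrow> real ^ 'd ^ 'm) \<Rightarrow> (real ^ 'm \<Rightarrow> real) \<Rightarrow>
     real ^ 'm \<Rightarrow> (real \<Rightarrow> real ^ 'd) \<Rightarrow> nat \<Rightarrow> real" where
  "em_time f g h X0 w n = fst (adaptive_em f g h X0 w n)"

definition num_steps ::
    "(real ^ 'm \<Rightarrow> real ^ 'm) \<Rightarrow> (real ^ 'm \<Rightarrow> real ^ 'd ^ 'm) \<Rightarrow> (real ^ 'm \<Rightarrow> real) \<Rightarrow>
     real ^ 'm \<Rightarrow> real \<Rightarrow> (real \<Rightarrow> real ^ 'd) \<Rightarrow> enat" where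
  "num_steps f g h X0 T w =
     (if \<exists>n. em_time f g h X0 w n \<ge> T
      then enat (LEAST n. em_time f g h X0 w n \<ge> T) else \<infinity>)"

text \<open>Used for \<open>p > 0\<close> only, so that the power of \<open>\<infinity>\<close> is \<open>\<infinity>\<close>.\<close>

definition enat_powr :: "enat \<Rightarrow> real \<Rightarrow> ennreal" where
  "enat_powr N p = (case N of enat n \<Rightarrow> ennreal (real n powr p) | \<infinity> \<Rightarrow> \<infinity>)"

end

theory Submission
  imports Defs
begin

text \<open>
  Write \<open>t\<^sub>n, X\<^sub>n, h\<^sub>n\<close> for the time points, positions and steps of the scheme. Every step that ends before
  \<open>T\<close> contributes \<open>1 = h\<^sub>n (1 / h\<^sub>n)\<close> to the number of steps, the sum of those \<open>h\<^sub>n\<close> is less than \<open>T\<close>, and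
  \<open>1 / h\<^sub>n\<close> grows at most polynomially in \<open>X\<^sub>n\<close>. By a Jensen-type inequality (\<open>step_count_power_le\<close>) the
  \<open>P\<close>-th power of the number of steps is therefore at most a constant times
  \<open>1 + \<Sum>\<^sub>n h\<^sub>n (1 + |X\<^sub>n|\<^sup>2)\<^sup>K\<close>, summed over the \<open>n\<close> with \<open>t\<^bsub>n+1\<^esub> < T\<close>, where \<open>K\<close> depends on \<open>P\<close> and \<open>q\<close>.
  It suffices that this sum has finite expectation. Since the sum is infinite if \<open>T\<close> is never
  reached, this also shows that \<open>T\<close> is reached almost surely.

  The expectation of the sum is bounded by a discrete Lyapunov argument
  (\<open>summable_weighted_moments\<close>). The timestep condition gives
  \<open>1 + |x + h f(x)|\<^sup>2 \<le> (1 + |x|\<^sup>2)(1 + c h)\<close>, and the noise, being symmetric, contributes to the mean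
  of \<open>(1 + |X\<^bsub>n+1\<^esub>|\<^sup>2)\<^sup>K\<close> only at second order, that is at order \<open>h\<^sub>n\<close>. So one step multiplies the
  conditional mean by at most \<open>1 + C h\<^sub>n\<close> as long as \<open>h\<^sub>n < T\<close>, and this is guaranteed on the event
  \<open>t\<^bsub>n+1\<^esub> < T\<close>, which is known at time \<open>t\<^sub>n\<close>. Discounting by \<open>exp (- (C + 1) t\<^sub>n)\<close> turns the growth into a
  strict decrease with a surplus proportional to \<open>h\<^sub>n (1 + |X\<^sub>n|\<^sup>2)\<^sup>K\<close>; telescoping bounds the sum of all
  surpluses by the initial value.

  The delicate point is that \<open>\<Delta>W\<^sub>n\<close> is an increment between random times. It is approximated by
  increments between the random times rounded up to the grid of mesh \<open>1 / (j + 1)\<close>. On the event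
  that the rounded times have two given values, the increment is one between deterministic
  times and independent of the past (\<open>nn_integral_step_in_cell\<close>); there the event and
  \<open>(t\<^sub>n, X\<^sub>n)\<close> can be read off from the path stopped at the first of the two values
  (\<open>stopped_eq\<close>), which makes them measurable with respect to the past. Continuity of the paths and Fatou's lemma remove the rounding
  (\<open>one_step_moment\<close>).
\<close>

section \<open>Time points and positions as functionals of the driving path\<close>

abbreviation em_pos where "em_pos f g h X0 w n \<equiv> snd (adaptive_em f g h X0 w n)"

lemma em_time_0 [simp]: "em_time f g h X0 w 0 = 0"
  by (simp add: em_time_def)

lemma em_time_Suc: "em_time f g h X0 w (Suc n) = em_time f g h X0 w n + h (em_pos f g h X0 w n)"
  by (simp add: em_time_def Let_def split_beta)

lemma em_pos_Suc:
  "em_pos f g h X0 w (Suc n) =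
     em_pos f g h X0 w n + h (em_pos f g h X0 w n) *\<^sub>R f (em_pos f g h X0 w n)
     + g (em_pos f g h X0 w n) *v (w (em_time f g h X0 w (Suc n)) - w (em_time f g h X0 w n))"
  by (simp add: em_time_def Let_def split_beta)

lemma em_time_nonneg:
  assumes "\<And>x. h x > 0"
  shows "0 \<le> em_time f g h X0 w n"
  by (induction n) (use assms in \<open>simp_all add: em_time_Suc add_nonneg_nonneg less_imp_le\<close>)

lemma em_time_mono:
  assumes "\<And>x. h x > 0" "i \<le> j"
  shows "em_time f g h X0 w i \<le> em_time f g h X0 w j"
  using assms(2) by (rule lift_Suc_mono_le[rotated]) (use assms(1) in \<open>auto simp: em_time_Suc intro: less_imp_le\<close>)

text \<open>
  Time points only increase, so the values computed up to a time point not later than \<open>s\<close> involve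
  the driving path on \<open>[0, s]\<close> only. This is what later makes events about the scheme adapted.
\<close>

lemma adaptive_em_local:
  assumes h: "\<And>x. h x > 0"
    and eq: "\<And>r. 0 \<le> r \<Longrightarrow> r \<le> s \<Longrightarrow> w r = w' r"
    and le: "em_time f g h X0 w n \<le> s"
  shows "adaptive_em f g h X0 w n = adaptive_em f g h X0 w' n"
  using le
proof (induction n)
  case (Suc n)
  let ?t = "em_time f g h X0 w" and ?t' = "em_time f g h X0 w'"
  have le: "?t n \<le> s"
    using em_time_mono[of h n "Suc n" f g X0 w] h Suc.prems by auto
  have IH: "adaptive_em f g h X0 w n = adaptive_em f g h X0 w' n"
    by (rule Suc.IH[OF le])
  have 1: "?t' n = ?t n" "?t' (Suc n) = ?t (Suc n)"
    using IH by (simp_all add: em_time_Suc) (simp_all add: em_time_def)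
  have "w (?t n) = w' (?t n)" "w (?t (Suc n)) = w' (?t (Suc n))"
    using le Suc.prems em_time_nonneg[of h, OF h] by (auto intro!: eq)
  then have "em_pos f g h X0 w (Suc n) = em_pos f g h X0 w' (Suc n)"
    unfolding em_pos_Suc 1 using IH by simp
  with 1(2) show ?case
    by (simp only: em_time_def prod_eq_iff)
qed simp

definition grid :: "nat \<Rightarrow> nat \<Rightarrow> real" where
  "grid j k = real k / real (Suc j)"

text \<open>
  Rounding is upwards, so that the rounded time is at or after the time at which the scheme
  decides about its next step; no information about the future enters.
\<close>

definition grid_index :: "nat \<Rightarrow> real \<Rightarrow> nat" where
  "grid_index j t = nat \<lceil>t * real (Suc j)\<rceil>"

lemma grid_nonneg: "0 \<le> grid j k"
  by (simp add: grid_def)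

lemma grid_index_bounds:
  assumes "0 \<le> t"
  shows "t \<le> grid j (grid_index j t)" "grid j (grid_index j t) \<le> t + 1 / real (Suc j)"
proof -
  have *: "real (nat \<lceil>t * real (Suc j)\<rceil>) = of_int \<lceil>t * real (Suc j)\<rceil>"
    using assms by (simp add: order_less_le_trans[of "-1" 0])
  show "t \<le> grid j (grid_index j t)"
    using le_of_int_ceiling[of "t * real (Suc j)"]
    unfolding grid_def grid_index_def * by (simp add: field_simps)
  have "of_int \<lceil>t * real (Suc j)\<rceil> / real (Suc j) \<le> (t * real (Suc j) + 1) / real (Suc j)"
    by (intro divide_right_mono) linarith+
  also have "\<dots> = t + 1 / real (Suc j)"
    by (simp add: add_divide_distrib)
  finally show "grid j (grid_index j t) \<le> t + 1 / real (Suc j)"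
    unfolding grid_def grid_index_def * .
qed

lemma tendsto_grid:
  assumes "0 \<le> t"
  shows "(\<lambda>j. grid j (grid_index j t)) \<longlonglongrightarrow> t"
    and "(\<lambda>j. grid j (Suc (grid_index j t))) \<longlonglongrightarrow> t"
proof -
  have l: "(\<lambda>j. 1 / real (Suc j)) \<longlonglongrightarrow> 0"
    using LIMSEQ_inverse_real_of_nat by (simp add: inverse_eq_divide)
  have u: "(\<lambda>j. t + 1 / real (Suc j)) \<longlonglongrightarrow> t"
    using tendsto_add[OF tendsto_const l, of t] by simp
  show 1: "(\<lambda>j. grid j (grid_index j t)) \<longlonglongrightarrow> t"
    using grid_index_bounds[OF assms]
    by (intro tendsto_sandwich[OF always_eventually always_eventually tendsto_const u]) blast+
  have "(\<lambda>j. grid j (grid_index j t) + 1 / real (Suc j)) \<longlonglongrightarrow> t + 0"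
    by (rule tendsto_add[OF 1 l])
  moreover have "grid j k + 1 / real (Suc j) = grid j (Suc k)" for j k
    by (simp add: grid_def add_divide_distrib)
  ultimately show "(\<lambda>j. grid j (Suc (grid_index j t))) \<longlonglongrightarrow> t"
    by simp
qed

lemma grid_index_measurable [measurable]: "grid_index j \<in> borel \<rightarrow>\<^sub>M count_space UNIV"
  unfolding grid_index_def by measurable

text \<open>
  Rounding the random time to a grid leaves countably many values, where measurability holds
  piecewise, and continuity of the paths gives the limit.
\<close>

lemma borel_measurable_at_random_time:
  fixes V :: "real \<Rightarrow> 'a \<Rightarrow> 'b :: metric_space"
  assumes meas: "\<And>r. 0 \<le> r \<Longrightarrow> V r \<in> borel_measurable N"
    and cont: "\<And>\<omega>. \<omega> \<in> space N \<Longrightarrow> continuous_on {0..} (\<lambda>r. V r \<omega>)"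
    and \<tau>: "\<tau> \<in> borel_measurable N" "\<And>\<omega>. \<omega> \<in> space N \<Longrightarrow> 0 \<le> \<tau> \<omega>"
  shows "(\<lambda>\<omega>. V (\<tau> \<omega>) \<omega>) \<in> borel_measurable N"
proof (rule borel_measurable_LIMSEQ_metric)
  fix j
  note [measurable] = \<tau>(1)
  show "(\<lambda>\<omega>. V (grid j (grid_index j (\<tau> \<omega>))) \<omega>) \<in> borel_measurable N"
    by (rule measurable_compose_countable[where g="\<lambda>\<omega>. grid_index j (\<tau> \<omega>)"])
       (auto intro: meas simp: grid_nonneg)
next
  fix \<omega> assume \<omega>: "\<omega> \<in> space N"
  show "(\<lambda>j. V (grid j (grid_index j (\<tau> \<omega>))) \<omega>) \<longlonglongrightarrow> V (\<tau> \<omega>) \<omega>"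
    using continuous_on_tendsto_compose[OF cont[OF \<omega>] tendsto_grid(1)[OF \<tau>(2)[OF \<omega>]]]
    by (auto simp: grid_nonneg \<tau>(2)[OF \<omega>])
qed

lemma borel_measurable_matrix_vector_mult:
  fixes A :: "'a \<Rightarrow> real ^ 'd ^ 'm"
  assumes "A \<in> borel_measurable N" "z \<in> borel_measurable N"
  shows "(\<lambda>\<omega>. A \<omega> *v z \<omega>) \<in> borel_measurable N"
  by (rule borel_measurable_continuous_Pair[OF assms])
     (unfold matrix_vector_mult_def, intro continuous_on_vec_lambda continuous_on_sum
        continuous_on_mult continuous_on_component continuous_on_fst continuous_on_snd continuous_on_id)

lemma adaptive_em_measurable:
  fixes V :: "real \<Rightarrow> 'a \<Rightarrow> real ^ 'd" and f :: "real ^ 'm \<Rightarrow> real ^ 'm"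
  assumes fgh: "continuous_on UNIV f" "continuous_on UNIV g" "continuous_on UNIV h"
    and h: "\<And>x. h x > 0"
    and meas: "\<And>r. 0 \<le> r \<Longrightarrow> V r \<in> borel_measurable N"
    and cont: "\<And>\<omega>. \<omega> \<in> space N \<Longrightarrow> continuous_on {0..} (\<lambda>r. V r \<omega>)"
  shows "(\<lambda>\<omega>. adaptive_em f g h X0 (\<lambda>r. V r \<omega>) n) \<in> N \<rightarrow>\<^sub>M borel \<Otimes>\<^sub>M borel"
proof (induction n)
  case (Suc n)
  let ?w = "\<lambda>\<omega> r. V r \<omega>"
  have t: "(\<lambda>\<omega>. em_time f g h X0 (?w \<omega>) n) \<in> borel_measurable N"
    and x: "(\<lambda>\<omega>. em_pos f g h X0 (?w \<omega>) n) \<in> borel_measurable N"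
    unfolding em_time_def using measurable_fst'[OF Suc.IH] measurable_snd'[OF Suc.IH] by auto
  note fgh_x = measurable_compose[OF x borel_measurable_continuous_onI[OF fgh(1)]]
    measurable_compose[OF x borel_measurable_continuous_onI[OF fgh(2)]]
    measurable_compose[OF x borel_measurable_continuous_onI[OF fgh(3)]]
  have t': "(\<lambda>\<omega>. em_time f g h X0 (?w \<omega>) (Suc n)) \<in> borel_measurable N"
    unfolding em_time_Suc by (rule borel_measurable_add[OF t fgh_x(3)])
  have V: "(\<lambda>\<omega>. V (em_time f g h X0 (?w \<omega>) i) \<omega>) \<in> borel_measurable N"
    if "(\<lambda>\<omega>. em_time f g h X0 (?w \<omega>) i) \<in> borel_measurable N" for i
    by (rule borel_measurable_at_random_time[OF meas cont that em_time_nonneg[OF h]])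
  have pos: "(\<lambda>\<omega>. em_pos f g h X0 (?w \<omega>) (Suc n)) \<in> borel_measurable N"
    unfolding em_pos_Suc
    by (rule borel_measurable_add[OF borel_measurable_add[OF x borel_measurable_scaleR[OF fgh_x(3) fgh_x(1)]]
        borel_measurable_matrix_vector_mult[OF fgh_x(2) borel_measurable_diff[OF V[OF t'] V[OF t]]]])
  show ?case
    using measurable_Pair[OF t' pos] by (simp only: em_time_def prod.collapse)
qed simp

section \<open>Gaussian averages of powers of 1 + |x|^2\<close>

lemma power_le_fact_mult_exp:
  fixes x :: real
  assumes "0 \<le> x"
  shows "x ^ n \<le> fact n * exp x"
proof -
  have "sum (\<lambda>i. x ^ i /\<^sub>R fact i) {n} \<le> (\<Sum>i. x ^ i /\<^sub>R fact i)"
    by (rule sum_le_suminf) (use assms summable_exp_generic[of x] in auto)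
  then show ?thesis
    by (simp add: exp_def field_simps)
qed

text \<open>
  A Taylor bound to second order. The linear term is kept exact, so that it cancels between
  \<open>r\<close> and \<open>- r\<close> in the symmetrised estimates below.
\<close>

lemma one_plus_power_le:
  fixes r :: real
  assumes "\<bar>r\<bar> \<le> 1"
  shows "(1 + r) ^ n \<le> 1 + real n * r + 4 ^ n * r\<^sup>2"
proof (induction n)
  case (Suc n)
  have "(1 + r) ^ Suc n \<le> (1 + real n * r + 4 ^ n * r\<^sup>2) * (1 + r)"
    using mult_right_mono[OF Suc.IH, of "1 + r"] assms by (simp add: mult.commute)
  also have "\<dots> = 1 + real (Suc n) * r + (real n + 4 ^ n + 4 ^ n * r) * r\<^sup>2"
    by (simp add: algebra_simps power2_eq_square)
  also have "\<dots> \<le> 1 + real (Suc n) * r + 4 ^ Suc n * r\<^sup>2"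
  proof -
    have "real n \<le> 4 ^ n"
      using of_nat_le_iff[of n "4 ^ n", where ?'a=real] less_exp[of n] power_mono[of 2 "4::nat" n] by simp
    moreover have "4 ^ n * r \<le> 4 ^ n"
      using assms by simp
    moreover have "(4 :: real) ^ Suc n = 4 * 4 ^ n" "(0 :: real) \<le> 4 ^ n"
      by simp_all
    ultimately have "real n + 4 ^ n + 4 ^ n * r \<le> 4 ^ Suc n"
      by linarith
    then show ?thesis
      by (intro add_left_mono mult_right_mono) auto
  qed
  finally show ?case .
qed simp

lemma symmetric_power_sum_le:
  fixes P Q :: real
  assumes "0 < P" "\<bar>Q\<bar> \<le> P"
  shows "(P + Q) ^ (k + 2) + (P - Q) ^ (k + 2) \<le> 2 * (P ^ (k + 2) + 4 ^ (k + 2) * Q\<^sup>2 * P ^ k)"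
proof -
  \<comment> \<open>Scaling by \<open>P\<close> brings the quotient into \<open>[-1, 1]\<close>, where the Taylor bound applies.\<close>
  define r where "r = Q / P"
  have r: "\<bar>r\<bar> \<le> 1" and Q: "Q = P * r"
    using assms by (auto simp: r_def abs_div field_simps)
  have "(P + Q) ^ (k + 2) + (P - Q) ^ (k + 2) = P ^ (k + 2) * ((1 + r) ^ (k + 2) + (1 + - r) ^ (k + 2))"
    unfolding distrib_left power_mult_distrib[symmetric] by (simp add: Q algebra_simps)
  also have "\<dots> \<le> P ^ (k + 2) * (2 + 2 * 4 ^ (k + 2) * r\<^sup>2)"
    using one_plus_power_le[of r "k + 2"] one_plus_power_le[of "- r" "k + 2"] r assms
    by (intro mult_left_mono) auto
  also have "\<dots> = 2 * (P ^ (k + 2) + 4 ^ (k + 2) * Q\<^sup>2 * P ^ k)"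
    by (simp add: Q power_mult_distrib algebra_simps power_add power2_eq_square)
  finally show ?thesis .
qed

lemma one_plus_power_le_linear:
  fixes u :: real
  assumes "0 \<le> u"
  shows "(1 + u) ^ n \<le> 1 + real n * u * (1 + u) ^ n"
proof (induction n)
  case (Suc n)
  have "(1 + u) ^ Suc n = (1 + u) ^ n + u * (1 + u) ^ n"
    by (simp add: algebra_simps)
  also have "\<dots> \<le> 1 + real n * u * (1 + u) ^ n + u * (1 + u) ^ n"
    using Suc.IH by simp
  also have "\<dots> = 1 + real (Suc n) * u * (1 + u) ^ n"
    by (simp add: algebra_simps)
  also have "\<dots> \<le> 1 + real (Suc n) * u * (1 + u) ^ Suc n"
    using assms by (intro add_left_mono mult_left_mono power_increasing) auto
  finally show ?case .
qed simp

text \<open>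
  The mean over the two outcomes \<open>y + v\<close> and \<open>y - v\<close> of a symmetric noise. Adding 1 to their squared
  norms gives \<open>P + Q\<close> and \<open>P - Q\<close> with \<open>Q = 2 (y \<bullet> v)\<close>. The part linear in \<open>Q\<close> cancels, and
  \<open>Q\<^sup>2\<close> is of order \<open>|v|\<^sup>2\<close>, so the relative growth is of order \<open>a + b\<close> instead of \<open>a + sqrt b\<close>.
\<close>

lemma symmetric_lyapunov:
  fixes y v :: "'a :: real_inner"
  assumes S: "1 \<le> S" and ab: "0 \<le> a" "0 \<le> b"
    and y: "1 + (norm y)\<^sup>2 \<le> S * (1 + a)" and v: "(norm v)\<^sup>2 \<le> S * b"
  shows "(1 + (norm (y + v))\<^sup>2) ^ (k + 2) + (1 + (norm (y - v))\<^sup>2) ^ (k + 2)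
    \<le> 2 * S ^ (k + 2) * (1 + (real (k + 2) + 4 ^ (k + 3)) * ((a + b) * (1 + a + b) ^ (k + 2)))"
proof -
  define P where "P = 1 + (norm y)\<^sup>2 + (norm v)\<^sup>2"
  define Q where "Q = 2 * (y \<bullet> v)"
  define u where "u = a + b"
  have u: "0 \<le> u" "1 + a + b = 1 + u" using ab by (auto simp: u_def)
  have PQ: "1 + (norm (y + v))\<^sup>2 = P + Q" "1 + (norm (y - v))\<^sup>2 = P - Q"
    by (simp_all add: P_def Q_def power2_norm_eq_inner algebra_simps inner_commute)
  have P0: "0 < P" by (simp add: P_def add_pos_nonneg)
  have "0 < P + Q" "0 < P - Q"
    unfolding PQ[symmetric] by (simp_all add: add_pos_nonneg)
  then have Q: "\<bar>Q\<bar> \<le> P" by auto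
  have P: "P \<le> S * (1 + u)"
    using y v by (simp add: P_def u_def algebra_simps)
  have "Q\<^sup>2 = 4 * (y \<bullet> v)\<^sup>2"
    by (simp add: Q_def power_mult_distrib)
  also have "(y \<bullet> v)\<^sup>2 \<le> (norm y)\<^sup>2 * (norm v)\<^sup>2"
    using Cauchy_Schwarz_ineq[of y v] by (simp add: power2_norm_eq_inner)
  also have "(norm y)\<^sup>2 * (norm v)\<^sup>2 \<le> (S * (1 + u)) * (S * u)"
  proof (intro mult_mono)
    show "(norm y)\<^sup>2 \<le> S * (1 + u)"
      using P zero_le_power2[of "norm v"] unfolding P_def by linarith
    have "S * b \<le> S * u" using S ab by (simp add: u_def)
    with v show "(norm v)\<^sup>2 \<le> S * u" by linarith
  qed (use S u in auto)
  finally have Q2: "Q\<^sup>2 \<le> 4 * (S ^ 2 * (1 + u) * u)"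
    by (simp add: power2_eq_square algebra_simps)
  have "(P + Q) ^ (k + 2) + (P - Q) ^ (k + 2) \<le> 2 * (P ^ (k + 2) + 4 ^ (k + 2) * Q\<^sup>2 * P ^ k)"
    by (rule symmetric_power_sum_le[OF P0 Q])
  also have "\<dots> \<le> 2 * ((S * (1 + u)) ^ (k + 2)
      + 4 ^ (k + 2) * (4 * (S ^ 2 * (1 + u) * u)) * (S * (1 + u)) ^ k)"
    using P0 P Q2 S u by (intro mult_left_mono add_mono mult_mono power_mono) auto
  also have "\<dots> = 2 * S ^ (k + 2) * ((1 + u) ^ (k + 2) + 4 ^ (k + 3) * u * (1 + u) ^ (k + 1))"
    unfolding power_mult_distrib power_add
    by (simp only: distrib_left power2_eq_square power3_eq_cube mult_ac power_one_right)
       (simp add: mult_ac ring_distribs)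
  also have "\<dots> \<le> 2 * S ^ (k + 2) * ((1 + real (k + 2) * u * (1 + u) ^ (k + 2)) 
      + 4 ^ (k + 3) * u * (1 + u) ^ (k + 2))"
    using u S by (intro mult_left_mono add_mono one_plus_power_le_linear power_increasing) auto
  finally show ?thesis
    unfolding PQ u u_def[symmetric] by (simp add: algebra_simps)
qed

lemma matrix_vector_mult_uminus: "(A :: real ^ 'd ^ 'm) *v (- z) = - (A *v z)"
  using matrix_vector_mult_diff_distrib[of A 0 z] by simp

lemma power2_norm_vec: "(norm (x :: 'b :: real_normed_vector ^ 'n))\<^sup>2 = (\<Sum>i\<in>UNIV. (norm (x $ i))\<^sup>2)"
  by (simp add: norm_vec_def L2_set_def sum_nonneg)

lemma norm_matrix_vector_mult_le:
  fixes A :: "real ^ 'd ^ 'm"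
  shows "(norm (A *v z))\<^sup>2 \<le> (norm A)\<^sup>2 * (norm z)\<^sup>2"
proof -
  have "(norm (A *v z))\<^sup>2 = (\<Sum>i\<in>UNIV. (A $ i \<bullet> z)\<^sup>2)"
    by (simp add: power2_norm_vec matrix_vector_mul_component)
  also have "\<dots> \<le> (\<Sum>i\<in>UNIV. (norm (A $ i))\<^sup>2 * (norm z)\<^sup>2)"
    using Cauchy_Schwarz_ineq by (intro sum_mono) (auto simp: power2_norm_eq_inner)
  also have "\<dots> = (norm A)\<^sup>2 * (norm z)\<^sup>2"
    unfolding sum_distrib_right[symmetric]
    by (simp add: power2_norm_vec[of A])
  finally show ?thesis .
qed

definition gauss_density :: "real \<Rightarrow> real ^ 'd \<Rightarrow> real" where
  "gauss_density v z = (\<Prod>i\<in>UNIV. normal_density 0 (sqrt v) (z $ i))"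

lemma gauss_density_nonneg [simp]: "0 \<le> gauss_density v z"
  by (simp add: gauss_density_def prod_nonneg)

lemma gauss_density_measurable [measurable]: "gauss_density v \<in> borel_measurable borel"
proof -
  have "(\<lambda>z :: real ^ 'd. z $ i) \<in> borel_measurable borel" for i
    by (intro borel_measurable_continuous_onI continuous_on_component continuous_on_id)
  then show ?thesis
    unfolding gauss_density_def [abs_def]
    by (intro borel_measurable_prod measurable_compose[OF _ borel_measurable_normal_density])
qed

lemma gauss_density_eq:
  fixes z :: "real ^ 'd"
  assumes "0 < v"
  shows "gauss_density v z = (1 / sqrt (2 * pi * v)) ^ CARD('d) * exp (- (norm z)\<^sup>2 / (2 * v))"
proof -
  have "(\<Sum>i\<in>UNIV. - (z $ i)\<^sup>2 / (2 * v)) = - (norm z)\<^sup>2 / (2 * v)"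
    by (simp add: power2_norm_vec sum_negf sum_divide_distrib)
  then show ?thesis
    using assms
    by (simp add: gauss_density_def normal_density_def prod.distrib prod_dividef flip: exp_sum)
       (simp add: power_divide)
qed

lemma gauss_density_uminus [simp]: "gauss_density v (- z) = gauss_density v z"
  by (simp add: gauss_density_def normal_density_def)

text \<open>
  Polynomial weights will be dominated by this exponential, and the product is again a multiple
  of a Gaussian density, of twice the variance. Moments of the Gaussian are thereby controlled by
  the total mass of another one.
\<close>

lemma gauss_density_mult_exp:
  fixes z :: "real ^ 'd"
  assumes "0 < v"
  shows "gauss_density v z * exp ((norm z)\<^sup>2 / (4 * v)) = sqrt 2 ^ CARD('d) * gauss_density (2 * v) z"
proof -
  have 1: "exp (- (norm z)\<^sup>2 / (2 * v)) * exp ((norm z)\<^sup>2 / (4 * v)) = exp (- (norm z)\<^sup>2 / (2 * (2 * v)))"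
    unfolding exp_add[symmetric] by (rule arg_cong[where f=exp]) (use assms in \<open>simp add: field_simps\<close>)
  have 2: "(1 / sqrt (2 * pi * v)) ^ CARD('d) = sqrt 2 ^ CARD('d) * (1 / sqrt (2 * pi * (2 * v))) ^ CARD('d)"
    unfolding power_mult_distrib[symmetric]
    by (rule arg_cong[where f="\<lambda>x. x ^ _"]) (use assms in \<open>simp add: real_sqrt_mult field_simps\<close>)
  show ?thesis
    using assms unfolding gauss_density_eq[OF assms] gauss_density_eq[OF mult_pos_pos[OF zero_less_numeral assms]]
    by (subst (1) 2) (simp only: mult.assoc 1)
qed

lemma nn_integral_gauss_density_symmetric:
  fixes \<phi> :: "real ^ 'd \<Rightarrow> ennreal"
  assumes [measurable]: "\<phi> \<in> borel_measurable borel"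
  shows "(\<integral>\<^sup>+z. gauss_density v z * \<phi> z \<partial>lborel) = (\<integral>\<^sup>+z. gauss_density v z * \<phi> (- z) \<partial>lborel)"
proof -
  have "lborel = distr lborel borel (\<lambda>z :: real ^ 'd. - z)"
    using lborel_affine[of "-1" "0 :: real ^ 'd"] by (simp add: density_1)
  then have "(\<integral>\<^sup>+z. gauss_density v z * \<phi> z \<partial>lborel)
      = (\<integral>\<^sup>+z. gauss_density v z * \<phi> z \<partial>distr lborel borel (\<lambda>z :: real ^ 'd. - z))"
    by simp
  also have "\<dots> = (\<integral>\<^sup>+z. gauss_density v z * \<phi> (- z) \<partial>lborel)"
    by (subst nn_integral_distr) auto
  finally show ?thesis .
qed

text \<open>
  With \<open>n = |z|\<^sup>2\<close> and \<open>w = n / v\<close>, the factor \<open>h + n\<close> is at most \<open>(h + v) (1 + w)\<close> and the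
  remaining factor is at most a power of \<open>1 + w\<close>; powers of \<open>1 + w\<close> are absorbed by \<open>exp (w / 4)\<close>.
  The small factor \<open>h + v\<close> survives, and the constant is uniform in bounded \<open>h\<close> and \<open>v\<close>.
\<close>

lemma gaussian_weight_bound:
  fixes c H :: real
  assumes "0 \<le> c" "0 \<le> H"
  obtains C where "0 \<le> C"
    "\<And>h v n. 0 \<le> h \<Longrightarrow> h \<le> H \<Longrightarrow> 0 < v \<Longrightarrow> v \<le> H \<Longrightarrow> 0 \<le> n \<Longrightarrow>
      (c * (h + n)) * (1 + c * (h + n)) ^ K \<le> C * (h + v) * exp (n / (4 * v))"
proof
  \<comment> \<open>The remaining factor of \<open>C\<close> comes from \<open>s\<^sup>n \<le> n! exp s\<close> at \<open>s = (1 + w) / 4\<close> and \<open>n = K + 1\<close>.\<close>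
  define B where "B = c * (1 + 2 * c * H) ^ K"
  define C where "C = B * (4 ^ (K + 1) * fact (K + 1) * exp (1 / 4))"
  have B: "0 \<le> B" using assms by (simp add: B_def)
  then show "0 \<le> C" by (simp add: C_def)
  fix h v n :: real
  assume *: "0 \<le> h" "h \<le> H" "0 < v" "v \<le> H" "0 \<le> n"
  define w where "w = n / v"
  have w: "0 \<le> w" "n = v * w" using * by (auto simp: w_def)
  have "h * w \<ge> 0" "H * w \<ge> 0" "v * w \<le> H * w" "h * w \<le> H * w" using * w assms by (auto intro: mult_right_mono)
  have hn: "h + n \<le> (h + v) * (1 + w)"
    using * w by (simp add: algebra_simps)
  have "(h + v) * (1 + w) \<le> 2 * H * (1 + w)"
    using * w by (intro mult_right_mono) auto
  with hn have "c * (h + n) \<le> c * (2 * H * (1 + w))"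
    using assms by (intro mult_left_mono) auto
  then have one: "1 + c * (h + n) \<le> (1 + 2 * c * H) * (1 + w)"
    using w by (simp add: algebra_simps)
  have "(c * (h + n)) * (1 + c * (h + n)) ^ K \<le> (c * ((h + v) * (1 + w))) * ((1 + 2 * c * H) * (1 + w)) ^ K"
    using * w assms hn one by (intro mult_mono power_mono mult_left_mono) auto
  also have "\<dots> = B * (h + v) * (1 + w) ^ (K + 1)"
    by (simp add: B_def power_mult_distrib)
  also have "(1 + w) ^ (K + 1) = 4 ^ (K + 1) * ((1 + w) / 4) ^ (K + 1)"
    by (simp add: power_divide)
  also have "B * (h + v) * (4 ^ (K + 1) * ((1 + w) / 4) ^ (K + 1))
      \<le> B * (h + v) * (4 ^ (K + 1) * (fact (K + 1) * exp ((1 + w) / 4)))"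
    using w B * by (intro mult_left_mono power_le_fact_mult_exp) auto
  also have "exp ((1 + w) / 4) = exp (1 / 4) * exp (n / (4 * v))"
    by (simp add: w_def add_divide_distrib exp_add)
  finally show "(c * (h + n)) * (1 + c * (h + n)) ^ K \<le> C * (h + v) * exp (n / (4 * v))"
    by (simp only: C_def mult_ac)
qed

text \<open>
  One Euler step with timestep \<open>h\<close> and a Gaussian increment of variance \<open>v\<close>, with \<open>y\<close> the position
  after the drift and \<open>A\<close> the diffusion matrix. The two parameters \<open>h\<close> and \<open>v\<close> are kept apart because
  rounding the times changes the variance but not the timestep. That the density is
  normalised is assumed here since for increments of a Brownian motion it is immediate.
\<close>

lemma gaussian_lyapunov:
  fixes c H :: real
  assumes c: "0 \<le> c" "0 \<le> H"
  obtains C where "0 \<le> C"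
    "\<And>h v S (y :: real ^ 'm) (A :: real ^ 'd ^ 'm). 0 \<le> h \<Longrightarrow> h \<le> H \<Longrightarrow> 0 < v \<Longrightarrow> v \<le> H \<Longrightarrow> 1 \<le> S \<Longrightarrow>
      1 + (norm y)\<^sup>2 \<le> S * (1 + c * h) \<Longrightarrow> (norm A)\<^sup>2 \<le> S * c \<Longrightarrow>
      (\<integral>\<^sup>+z. gauss_density v (z :: real ^ 'd) \<partial>lborel) = 1 \<Longrightarrow>
      (\<integral>\<^sup>+z. gauss_density (2 * v) (z :: real ^ 'd) \<partial>lborel) = 1 \<Longrightarrow>
      (\<integral>\<^sup>+z. gauss_density v z * ennreal ((1 + (norm (y + A *v z))\<^sup>2) ^ (k + 2)) \<partial>lborel)
        \<le> ennreal (S ^ (k + 2) * (1 + C * (h + v)))"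
proof -
  obtain B where B: "0 \<le> B" and bound: "\<And>h v n. 0 \<le> h \<Longrightarrow> h \<le> H \<Longrightarrow> 0 < v \<Longrightarrow> v \<le> H \<Longrightarrow> 0 \<le> n \<Longrightarrow>
      (c * (h + n)) * (1 + c * (h + n)) ^ (k + 2) \<le> B * (h + v) * exp (n / (4 * v))"
    using gaussian_weight_bound[OF c, where K="k + 2"] by blast
  define L where "L = (real (k + 2) + 4 ^ (k + 3)) * B"
  have L: "0 \<le> L" using B by (simp add: L_def)
  show ?thesis
  proof (rule that)
    show "0 \<le> L * sqrt 2 ^ CARD('d)" using L by simp
    fix h v S and y :: "real ^ 'm" and A :: "real ^ 'd ^ 'm"
    assume h: "0 \<le> h" "h \<le> H" and v: "0 < v" "v \<le> H" and S: "1 \<le> S"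
      and y: "1 + (norm y)\<^sup>2 \<le> S * (1 + c * h)" and A: "(norm A)\<^sup>2 \<le> S * c"
      and int1: "(\<integral>\<^sup>+z. gauss_density v (z :: real ^ 'd) \<partial>lborel) = 1"
      and int2: "(\<integral>\<^sup>+z. gauss_density (2 * v) (z :: real ^ 'd) \<partial>lborel) = 1"
    define \<phi> where "\<phi> z = (1 + (norm (y + A *v z))\<^sup>2) ^ (k + 2)" for z
    have \<phi>_nonneg: "0 \<le> \<phi> z" for z by (simp add: \<phi>_def)
    have [measurable]: "\<phi> \<in> borel_measurable borel"
      unfolding \<phi>_def[abs_def]
      by (intro borel_measurable_continuous_onI continuous_intros matrix_vector_mult_linear_continuous_on)
    have pw: "\<phi> z + \<phi> (- z) \<le> 2 * (S ^ (k + 2) * (1 + L * (h + v) * exp ((norm z)\<^sup>2 / (4 * v))))" for z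
    proof -
      have "(norm (A *v z))\<^sup>2 \<le> (S * c) * (norm z)\<^sup>2"
        using norm_matrix_vector_mult_le[of A z] mult_right_mono[OF A, of "(norm z)\<^sup>2"] by simp
      then have "\<phi> z + \<phi> (- z) \<le> 2 * S ^ (k + 2) * (1 + (real (k + 2) + 4 ^ (k + 3)) *
          ((c * h + c * (norm z)\<^sup>2) * (1 + c * h + c * (norm z)\<^sup>2) ^ (k + 2)))"
        using symmetric_lyapunov[OF S _ _ y, of "c * (norm z)\<^sup>2" "A *v z" k] c h
        by (simp add: \<phi>_def matrix_vector_mult_uminus mult.assoc)
      also have "\<dots> = 2 * S ^ (k + 2) * (1 + (real (k + 2) + 4 ^ (k + 3)) *
          ((c * (h + (norm z)\<^sup>2)) * (1 + c * (h + (norm z)\<^sup>2)) ^ (k + 2)))"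
        by (simp only: distrib_left add.assoc)
      also have "\<dots> \<le> 2 * S ^ (k + 2) * (1 + (real (k + 2) + 4 ^ (k + 3)) *
          (B * (h + v) * exp ((norm z)\<^sup>2 / (4 * v))))"
        using S by (intro mult_left_mono add_left_mono bound h v) auto
      finally show ?thesis
        by (simp only: L_def mult.assoc)
    qed
    \<comment> \<open>The Gaussian is even, so twice its integral of \<open>\<phi>\<close> is that of \<open>\<phi> z + \<phi> (- z)\<close>.\<close>
    let ?I = "\<integral>\<^sup>+z. gauss_density v z * ennreal (\<phi> z) \<partial>lborel"
    have "2 * ?I = ?I + (\<integral>\<^sup>+z. gauss_density v z * ennreal (\<phi> (- z)) \<partial>lborel)"
      using nn_integral_gauss_density_symmetric[of "\<lambda>z. ennreal (\<phi> z)" v] by (simp add: mult_2)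
    also have "\<dots> = (\<integral>\<^sup>+z. ennreal (gauss_density v z * (\<phi> z + \<phi> (- z))) \<partial>lborel)"
      by (subst nn_integral_add[symmetric])
         (auto simp: \<phi>_nonneg ennreal_mult ennreal_plus distrib_left)
    also have "\<dots> \<le> (\<integral>\<^sup>+z. ennreal (2 * (S ^ (k + 2) * (gauss_density v (z :: real ^ 'd)
        + L * sqrt 2 ^ CARD('d) * (h + v) * gauss_density (2 * v) z))) \<partial>lborel)"
    proof (intro nn_integral_mono ennreal_leI)
      fix z :: "real ^ 'd"
      have "gauss_density v z * (\<phi> z + \<phi> (- z))
          \<le> gauss_density v z * (2 * (S ^ (k + 2) * (1 + L * (h + v) * exp ((norm z)\<^sup>2 / (4 * v)))))"
        by (intro mult_left_mono pw) simp
      also have "\<dots> = 2 * (S ^ (k + 2) * (gauss_density v z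
          + L * (h + v) * (gauss_density v z * exp ((norm z)\<^sup>2 / (4 * v)))))"
        by (simp add: algebra_simps)
      finally show "gauss_density v z * (\<phi> z + \<phi> (- z)) \<le> 2 * (S ^ (k + 2) * (gauss_density v z
        + L * sqrt 2 ^ CARD('d) * (h + v) * gauss_density (2 * v) z))"
        unfolding gauss_density_mult_exp[OF v(1)] by (simp add: mult_ac)
    qed
    also have "\<dots> = 2 * ennreal (S ^ (k + 2) * (1 + L * sqrt 2 ^ CARD('d) * (h + v)))"
    proof -
      have "(\<integral>\<^sup>+z. ennreal (a * gauss_density v z + b * gauss_density (2 * v) (z :: real ^ 'd)) \<partial>lborel) = ennreal (a + b)"
        if "0 \<le> a" "0 \<le> b" for a b
        using that by (simp add: ennreal_mult nn_integral_add nn_integral_cmult int1 int2)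
      from this[of "2 * S ^ (k + 2)" "2 * S ^ (k + 2) * (L * sqrt 2 ^ CARD('d) * (h + v))"]
      show ?thesis
        using S L h v by (simp add: algebra_simps ennreal_mult' flip: ennreal_numeral)
    qed
    finally have "2 * ?I \<le> 2 * ennreal (S ^ (k + 2) * (1 + L * sqrt 2 ^ CARD('d) * (h + v)))" .
    then show "(\<integral>\<^sup>+z. gauss_density v z * ennreal ((1 + (norm (y + A *v z))\<^sup>2) ^ (k + 2)) \<partial>lborel)
        \<le> ennreal (S ^ (k + 2) * (1 + L * sqrt 2 ^ CARD('d) * (h + v)))"
      unfolding \<phi>_def by (subst (asm) ennreal_mult_le_mult_iff) auto
  qed
qed

section \<open>Brownian motion with continuous paths\<close>

lemma brownian_motion_measurable:
  assumes "normal_filtration M F" "brownian_motion M F W" "0 \<le> t"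
  shows "W t \<in> borel_measurable M"
  by (rule measurable_from_subalg[of M "F t"])
     (use assms in \<open>simp_all add: normal_filtration_def brownian_motion_def\<close>)

text \<open>
  The exceptional set of discontinuous paths is contained in a null set, which the normal
  filtration contains at time 0. Setting the motion to zero there keeps it adapted and changes
  neither distributions nor independence.
\<close>

lemma ex_continuous_modification:
  assumes M: "prob_space M" and F: "normal_filtration M F" and W: "brownian_motion M F W"
  obtains W' where "brownian_motion M F W'" "AE \<omega> in M. \<forall>t. W' t \<omega> = W t \<omega>"
    "\<And>\<omega>. \<omega> \<in> space M \<Longrightarrow> continuous_on {0..} (\<lambda>t. W' t \<omega>)"
proof -
  interpret prob_space M by (rule M)
  have "AE \<omega> in M. continuous_on {0..} (\<lambda>t. W t \<omega>)"
    using W by (simp add: brownian_motion_def)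
  then obtain N where N: "{\<omega> \<in> space M. \<not> continuous_on {0..} (\<lambda>t. W t \<omega>)} \<subseteq> N" "N \<in> null_sets M"
    by (auto elim!: AE_E)
  define W' where "W' t \<omega> = (if \<omega> \<in> N then 0 else W t \<omega>)" for t \<omega>
  have AE_N: "AE \<omega> in M. \<omega> \<notin> N" by (rule AE_not_in[OF N(2)])
  have eq: "AE \<omega> in M. \<forall>t. W' t \<omega> = W t \<omega>"
    using AE_N by eventually_elim (simp add: W'_def)
  have adapted: "W' t \<in> borel_measurable (F t)" if "0 \<le> t" for t
  proof -
    have "N \<in> sets (F t)"
      using N(2) F that unfolding normal_filtration_def by blast
    moreover have "W t \<in> borel_measurable (F t)"
      using W that by (simp add: brownian_motion_def)
    ultimately show ?thesis
      unfolding W'_def[abs_def] by (intro measurable_If_set) auto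
  qed
  have meas': "W' t \<in> borel_measurable M" if "0 \<le> t" for t
    by (rule measurable_from_subalg[OF _ adapted[OF that]]) (use F that in \<open>simp add: normal_filtration_def\<close>)
  have cont: "continuous_on {0..} (\<lambda>t. W' t \<omega>)" if "\<omega> \<in> space M" for \<omega>
    using that N(1) by (cases "\<omega> \<in> N") (auto simp: W'_def)
  note meas = brownian_motion_measurable[OF F W]
  have "brownian_motion M F W'"
    unfolding brownian_motion_def
  proof (intro conjI allI impI)
    show "AE \<omega> in M. W' 0 \<omega> = 0"
    proof -
      have "AE \<omega> in M. W 0 \<omega> = 0" using W by (simp add: brownian_motion_def)
      then show ?thesis by eventually_elim (simp add: W'_def)
    qed
    show "AE \<omega> in M. continuous_on {0..} (\<lambda>t. W' t \<omega>)"
      by (rule AE_I2[OF cont])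
    fix s t :: real assume st: "0 \<le> s" "s < t"
    define X where "X \<omega> = W t \<omega> - W s \<omega>" for \<omega>
    define X' where "X' \<omega> = W' t \<omega> - W' s \<omega>" for \<omega>
    have X: "X \<in> borel_measurable M" and X': "X' \<in> borel_measurable M"
      using st meas meas' unfolding X_def[abs_def] X'_def[abs_def] by auto
    have XX': "AE \<omega> in M. X \<omega> = X' \<omega>"
      using eq by eventually_elim (simp add: X_def X'_def)
    have ind: "indep_set (sets (F s)) {X -` A \<inter> space M | A. A \<in> sets borel}"
      and dist: "distributed M lborel X (\<lambda>x. ennreal (\<Prod>i\<in>UNIV. normal_density 0 (sqrt (t - s)) (x $ i)))"
      using W st unfolding brownian_motion_def X_def by blast+
    show "distributed M lborel (\<lambda>\<omega>. W' t \<omega> - W' s \<omega>)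
        (\<lambda>x. ennreal (\<Prod>i\<in>UNIV. normal_density 0 (sqrt (t - s)) (x $ i)))"
    proof -
      have "distr M lborel X = distr M lborel X'"
        by (rule distr_cong_AE[OF refl refl XX']) (use X X' in auto)
      then show ?thesis
        using dist X' by (simp add: distributed_def X'_def[abs_def])
    qed
    have "indep_set (sets (F s)) {X' -` A \<inter> space M | A. A \<in> sets borel}"
    proof (rule indep_setI)
      show "sets (F s) \<subseteq> events" by (rule indep_setD_ev1[OF ind])
      show "{X' -` A \<inter> space M | A. A \<in> sets borel} \<subseteq> events"
        using X' by (auto intro: measurable_sets)
      fix a b assume a: "a \<in> sets (F s)" and "b \<in> {X' -` A \<inter> space M | A. A \<in> sets borel}"
      then obtain A where A: "A \<in> sets borel" and b: "b = X' -` A \<inter> space M" by auto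
      have sets: "a \<in> sets M" "X -` A \<inter> space M \<in> sets M" "b \<in> sets M"
        using a A X X' indep_setD_ev1[OF ind] by (auto simp: b intro: measurable_sets)
      have "prob (a \<inter> b) = prob (a \<inter> (X -` A \<inter> space M))" "prob b = prob (X -` A \<inter> space M)"
        by (rule measure_eq_AE; use sets XX' in \<open>auto simp: b\<close>)+
      moreover have "prob (a \<inter> (X -` A \<inter> space M)) = prob a * prob (X -` A \<inter> space M)"
        by (rule indep_setD[OF ind a]) (use A in auto)
      ultimately show "prob (a \<inter> b) = prob a * prob b" by simp
    qed
    then show "indep_set (sets (F s)) {(\<lambda>\<omega>. W' t \<omega> - W' s \<omega>) -` A \<inter> space M | A. A \<in> sets borel}"
      by (simp add: X'_def[abs_def])
  qed (use adapted in auto)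
  then show ?thesis
    by (rule that[OF _ eq cont])
qed

lemma nn_integral_mono_on_countable_partition:
  fixes c :: "'a \<Rightarrow> 'i :: countable"
  assumes c: "c \<in> M \<rightarrow>\<^sub>M count_space UNIV"
    and u: "u \<in> borel_measurable M" and v: "v \<in> borel_measurable M"
    and le: "\<And>i. (\<integral>\<^sup>+\<omega>. (if c \<omega> = i then u \<omega> else 0) \<partial>M) \<le> (\<integral>\<^sup>+\<omega>. (if c \<omega> = i then v \<omega> else 0) \<partial>M)"
  shows "(\<integral>\<^sup>+\<omega>. u \<omega> \<partial>M) \<le> (\<integral>\<^sup>+\<omega>. v \<omega> \<partial>M)"
proof -
  have split: "(\<integral>\<^sup>+\<omega>. w \<omega> \<partial>M) = (\<integral>\<^sup>+i. (\<integral>\<^sup>+\<omega>. (if c \<omega> = i then w \<omega> else 0) \<partial>M) \<partial>count_space UNIV)"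
    if "w \<in> borel_measurable M" for w
  proof -
    note [measurable] = c that
    have "(\<integral>\<^sup>+\<omega>. w \<omega> \<partial>M) = (\<integral>\<^sup>+\<omega>. (\<integral>\<^sup>+i. (if c \<omega> = i then w \<omega> else 0) \<partial>count_space UNIV) \<partial>M)"
    proof (rule nn_integral_cong)
      fix \<omega>
      have "(\<integral>\<^sup>+i. (if c \<omega> = i then w \<omega> else 0) \<partial>count_space UNIV)
          = (\<integral>\<^sup>+i. w \<omega> * indicator {c \<omega>} i \<partial>count_space UNIV)"
        by (intro nn_integral_cong) auto
      then show "w \<omega> = (\<integral>\<^sup>+i. (if c \<omega> = i then w \<omega> else 0) \<partial>count_space UNIV)"
        by (simp add: nn_integral_cmult)
    qed
    also have "\<dots> = (\<integral>\<^sup>+i. (\<integral>\<^sup>+\<omega>. (if c \<omega> = i then w \<omega> else 0) \<partial>M) \<partial>count_space UNIV)"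
      by (rule nn_integral_count_space_nn_integral) auto
    finally show ?thesis .
  qed
  show ?thesis
    unfolding split[OF u] split[OF v] by (intro nn_integral_mono le)
qed

locale continuous_brownian_motion = prob_space M for M :: "'a measure" +
  fixes F :: "real \<Rightarrow> 'a measure" and W :: "real \<Rightarrow> 'a \<Rightarrow> real ^ 'd"
  assumes filtration: "normal_filtration M F"
    and brownian: "brownian_motion M F W"
    and continuous_paths: "\<And>\<omega>. \<omega> \<in> space M \<Longrightarrow> continuous_on {0..} (\<lambda>t. W t \<omega>)"
begin

lemma subalg: "0 \<le> t \<Longrightarrow> subalgebra M (F t)"
  using filtration by (simp add: normal_filtration_def)

lemma W_measurable: "0 \<le> t \<Longrightarrow> W t \<in> borel_measurable M"
  by (rule brownian_motion_measurable[OF filtration brownian])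

lemma W_adapted: "0 \<le> s \<Longrightarrow> s \<le> t \<Longrightarrow> W s \<in> borel_measurable (F t)"
proof -
  assume "0 \<le> s" "s \<le> t"
  then have "subalgebra (F t) (F s)"
    using filtration by (auto simp: normal_filtration_def subalgebra_def)
  moreover have "W s \<in> borel_measurable (F s)"
    using brownian \<open>0 \<le> s\<close> by (simp add: brownian_motion_def)
  ultimately show ?thesis by (rule measurable_from_subalg)
qed

lemma increment_distributed:
  "0 \<le> s \<Longrightarrow> s < t \<Longrightarrow> distributed M lborel (\<lambda>\<omega>. W t \<omega> - W s \<omega>) (\<lambda>z. ennreal (gauss_density (t - s) z))"
  using brownian unfolding brownian_motion_def gauss_density_def by blast

text \<open>
  This is the density of \<open>W v - W 0\<close>, so its total mass is that of a probability distribution.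
\<close>

lemma gauss_density_total:
  assumes "0 < v"
  shows "(\<integral>\<^sup>+z. gauss_density v (z :: real ^ 'd) \<partial>lborel) = 1"
proof -
  let ?X = "\<lambda>\<omega>. W v \<omega> - W 0 \<omega>"
  have D: "distr M lborel ?X = density lborel (\<lambda>z. ennreal (gauss_density v z))"
    using increment_distributed[of 0 v] assms by (simp add: distributed_def)
  have "?X \<in> M \<rightarrow>\<^sub>M lborel"
    using assms W_measurable by auto
  then interpret D: prob_space "distr M lborel ?X"
    by (rule prob_space_distr)
  show ?thesis
    using D.emeasure_space_1 unfolding D by (simp add: emeasure_density)
qed

text \<open>
  Freezing the past: the variables \<open>Y\<close> known at time \<open>s\<close> and the increment after \<open>s\<close> have a product
  distribution, and Tonelli's theorem integrates the increment out.
\<close>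

lemma nn_integral_increment:
  fixes \<Psi> :: "'b \<times> (real ^ 'd) \<Rightarrow> ennreal"
  assumes st: "0 \<le> s" "s < t" and Y: "Y \<in> F s \<rightarrow>\<^sub>M N"
    and \<Psi>: "\<Psi> \<in> borel_measurable (N \<Otimes>\<^sub>M borel)"
  shows "(\<integral>\<^sup>+\<omega>. \<Psi> (Y \<omega>, W t \<omega> - W s \<omega>) \<partial>M)
    = (\<integral>\<^sup>+\<omega>. (\<integral>\<^sup>+z. gauss_density (t - s) z * \<Psi> (Y \<omega>, z) \<partial>lborel) \<partial>M)"
proof -
  let ?X = "\<lambda>\<omega>. W t \<omega> - W s \<omega>"
  have X: "?X \<in> M \<rightarrow>\<^sub>M borel"
    using st W_measurable by auto
  have YM: "Y \<in> M \<rightarrow>\<^sub>M N"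
    by (rule measurable_from_subalg[OF subalg[OF st(1)] Y])
  have ind: "indep_set (sets (F s)) {?X -` A \<inter> space M | A. A \<in> sets borel}"
    using brownian st by (simp add: brownian_motion_def)
  have distr: "distr M borel ?X = density lborel (\<lambda>z. ennreal (gauss_density (t - s) z))"
    using increment_distributed[OF st] by (simp add: distributed_def cong: distr_cong)
  interpret PX: prob_space "distr M borel ?X" by (rule prob_space_distr[OF X])
  interpret PY: prob_space "distr M N Y" by (rule prob_space_distr[OF YM])
  have joint: "distr M N Y \<Otimes>\<^sub>M distr M borel ?X = distr M (N \<Otimes>\<^sub>M borel) (\<lambda>\<omega>. (Y \<omega>, ?X \<omega>))"
  proof (rule pair_measure_eqI)
    fix A B assume "A \<in> sets (distr M N Y)" "B \<in> sets (distr M borel ?X)"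
    then have A: "A \<in> sets N" and B: "B \<in> sets borel" by simp_all
    let ?A = "Y -` A \<inter> space M" and ?B = "?X -` B \<inter> space M"
    have "space (F s) = space M"
      using subalg[OF st(1)] by (simp add: subalgebra_def)
    then have "?A \<in> sets (F s)"
      using measurable_sets[OF Y A] by simp
    moreover have "?B \<in> {?X -` A \<inter> space M | A. A \<in> sets borel}"
      using B by blast
    ultimately have "prob (?A \<inter> ?B) = prob ?A * prob ?B"
      by (rule indep_setD[OF ind])
    moreover have "(\<lambda>\<omega>. (Y \<omega>, ?X \<omega>)) -` (A \<times> B) \<inter> space M = ?A \<inter> ?B"
      by auto
    ultimately show "emeasure (distr M N Y) A * emeasure (distr M borel ?X) B
        = emeasure (distr M (N \<Otimes>\<^sub>M borel) (\<lambda>\<omega>. (Y \<omega>, ?X \<omega>))) (A \<times> B)"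
      using A B X YM by (simp add: emeasure_distr emeasure_eq_measure ennreal_mult')
  qed (auto intro: PX.sigma_finite_measure_axioms PY.sigma_finite_measure_axioms cong: sets_pair_measure_cong)
  have \<Psi>': "\<Psi> \<in> borel_measurable (distr M N Y \<Otimes>\<^sub>M distr M borel ?X)"
    using \<Psi> by (simp cong: measurable_cong_sets sets_pair_measure_cong)
  have "(\<integral>\<^sup>+\<omega>. \<Psi> (Y \<omega>, ?X \<omega>) \<partial>M) = (\<integral>\<^sup>+p. \<Psi> p \<partial>distr M (N \<Otimes>\<^sub>M borel) (\<lambda>\<omega>. (Y \<omega>, ?X \<omega>)))"
    using X YM \<Psi> by (subst nn_integral_distr) auto
  also have "\<dots> = (\<integral>\<^sup>+y. (\<integral>\<^sup>+z. \<Psi> (y, z) \<partial>distr M borel ?X) \<partial>distr M N Y)"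
    unfolding joint[symmetric] by (rule PX.nn_integral_fst[OF \<Psi>', symmetric])
  also have "\<dots> = (\<integral>\<^sup>+\<omega>. (\<integral>\<^sup>+z. \<Psi> (Y \<omega>, z) \<partial>distr M borel ?X) \<partial>M)"
    using PX.borel_measurable_nn_integral_fst[OF \<Psi>'] by (intro nn_integral_distr YM) simp
  also have "\<dots> = (\<integral>\<^sup>+\<omega>. (\<integral>\<^sup>+z. gauss_density (t - s) z * \<Psi> (Y \<omega>, z) \<partial>lborel) \<partial>M)"
  proof (rule nn_integral_cong)
    fix \<omega> assume "\<omega> \<in> space M"
    then have "Y \<omega> \<in> space N" by (rule measurable_space[OF YM])
    then have "(\<lambda>z. \<Psi> (Y \<omega>, z)) \<in> borel_measurable borel"
      by (intro measurable_compose[OF _ \<Psi>]) auto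
    then show "(\<integral>\<^sup>+z. \<Psi> (Y \<omega>, z) \<partial>distr M borel ?X) = (\<integral>\<^sup>+z. gauss_density (t - s) z * \<Psi> (Y \<omega>, z) \<partial>lborel)"
      unfolding distr by (subst nn_integral_density) auto
  qed
  finally show ?thesis .
qed

end

section \<open>One step of the scheme at random times\<close>

definition energy :: "nat \<Rightarrow> 'b :: real_normed_vector \<Rightarrow> real" where
  "energy k x = (1 + (norm x)\<^sup>2) ^ k"

lemma energy_ge_1: "1 \<le> energy k x"
  by (simp add: energy_def one_le_power)

lemma energy_measurable [measurable]:
  "energy k \<in> borel_measurable (borel :: 'b :: {real_normed_vector, second_countable_topology} measure)"
  unfolding energy_def[abs_def] by measurable

lemma grid_index_mono: "a \<le> b \<Longrightarrow> grid_index j a \<le> grid_index j b"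
  unfolding grid_index_def by (intro nat_mono ceiling_mono mult_right_mono) auto

text \<open>
  The growth conditions appear here only through their consequences for one step of the scheme,
  with a common constant.
\<close>

locale adaptive_scheme = continuous_brownian_motion M F W
  for M :: "'a measure" and F :: "real \<Rightarrow> 'a measure" and W :: "real \<Rightarrow> 'a \<Rightarrow> real ^ 'd" +
  fixes f :: "real ^ 'm \<Rightarrow> real ^ 'm" and g :: "real ^ 'm \<Rightarrow> real ^ 'd ^ 'm"
    and h :: "real ^ 'm \<Rightarrow> real" and X0 :: "real ^ 'm" and c :: real
  assumes cont_f: "continuous_on UNIV f" and cont_g: "continuous_on UNIV g" and cont_h: "continuous_on UNIV h"
    and h_pos: "\<And>x. 0 < h x" and c_nonneg: "0 \<le> c"
    and drift_growth: "\<And>x. 1 + (norm (x + h x *\<^sub>R f x))\<^sup>2 \<le> (1 + (norm x)\<^sup>2) * (1 + c * h x)"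
    and diffusion_growth: "\<And>x. (norm (g x))\<^sup>2 \<le> (1 + (norm x)\<^sup>2) * c"
begin

definition t :: "nat \<Rightarrow> 'a \<Rightarrow> real" where
  "t n \<omega> = em_time f g h X0 (\<lambda>r. W r \<omega>) n"

definition x :: "nat \<Rightarrow> 'a \<Rightarrow> real ^ 'm" where
  "x n \<omega> = em_pos f g h X0 (\<lambda>r. W r \<omega>) n"

lemma t_0: "t 0 \<omega> = 0" and x_0: "x 0 \<omega> = X0"
  by (simp_all add: t_def x_def)

lemma t_Suc: "t (Suc n) \<omega> = t n \<omega> + h (x n \<omega>)"
  by (simp only: t_def x_def em_time_Suc)

definition em_step :: "real ^ 'm \<Rightarrow> real ^ 'd \<Rightarrow> real ^ 'm" where
  "em_step y z = y + h y *\<^sub>R f y + g y *v z"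

lemma x_Suc: "x (Suc n) \<omega> = em_step (x n \<omega>) (W (t (Suc n) \<omega>) \<omega> - W (t n \<omega>) \<omega>)"
  by (simp only: t_def x_def em_pos_Suc em_step_def)

lemma t_nonneg: "0 \<le> t n \<omega>"
  unfolding t_def by (rule em_time_nonneg[OF h_pos])

lemma borel_fgh [measurable]:
  "f \<in> borel_measurable borel" "g \<in> borel_measurable borel" "h \<in> borel_measurable borel"
  by (intro borel_measurable_continuous_onI cont_f cont_g cont_h)+

lemma em_step_measurable [measurable (raw)]:
  assumes [measurable]: "u \<in> borel_measurable N" "v \<in> borel_measurable N"
  shows "(\<lambda>\<omega>. em_step (u \<omega>) (v \<omega>)) \<in> borel_measurable N"
proof -
  have [measurable]: "(\<lambda>\<omega>. g (u \<omega>) *v v \<omega>) \<in> borel_measurable N"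
    by (intro borel_measurable_matrix_vector_mult) measurable
  show ?thesis unfolding em_step_def by measurable
qed

lemma t_measurable [measurable]: "t n \<in> borel_measurable M"
  and x_measurable [measurable]: "x n \<in> borel_measurable M"
proof -
  have "(\<lambda>\<omega>. adaptive_em f g h X0 (\<lambda>r. W r \<omega>) n) \<in> M \<rightarrow>\<^sub>M borel \<Otimes>\<^sub>M borel"
    by (rule adaptive_em_measurable[OF cont_f cont_g cont_h h_pos W_measurable continuous_paths])
  from measurable_fst'[OF this] measurable_snd'[OF this]
  show "t n \<in> borel_measurable M" "x n \<in> borel_measurable M"
    unfolding t_def[abs_def] x_def[abs_def] em_time_def by auto
qed

text \<open>
  The scheme driven by the path stopped at \<open>s\<close>. It is computed from information available at time
  \<open>s\<close>, and agrees with the scheme itself whenever the \<open>n\<close>-th time point is at most \<open>s\<close>.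
\<close>

definition stopped :: "real \<Rightarrow> nat \<Rightarrow> 'a \<Rightarrow> real \<times> (real ^ 'm)" where
  "stopped s n \<omega> = adaptive_em f g h X0 (\<lambda>r. W (min r s) \<omega>) n"

lemma stopped_measurable:
  assumes s: "0 \<le> s"
  shows "stopped s n \<in> F s \<rightarrow>\<^sub>M borel \<Otimes>\<^sub>M borel"
  unfolding stopped_def[abs_def]
proof (rule adaptive_em_measurable[OF cont_f cont_g cont_h h_pos])
  fix r :: real assume "0 \<le> r"
  with s show "W (min r s) \<in> borel_measurable (F s)"
    by (intro W_adapted) auto
next
  fix \<omega> assume "\<omega> \<in> space (F s)"
  then have "\<omega> \<in> space M"
    using subalg[OF s] by (simp add: subalgebra_def)
  then show "continuous_on {0..} (\<lambda>r. W (min r s) \<omega>)"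
    by (intro continuous_on_compose2[OF continuous_paths, of \<omega> "{0..}" "\<lambda>r. min r s"] continuous_intros)
       (use s in auto)
qed

text \<open>
  Either side may witness that the \<open>n\<close>-th time point is at most \<open>s\<close>: locality applies to
  both the full and the stopped path. Hence the event itself can be expressed by the stopped scheme.
\<close>

lemma stopped_eq:
  assumes "t n \<omega> \<le> s \<or> fst (stopped s n \<omega>) \<le> s"
  shows "stopped s n \<omega> = (t n \<omega>, x n \<omega>)"
proof -
  have "stopped s n \<omega> = adaptive_em f g h X0 (\<lambda>r. W r \<omega>) n"
    using assms
  proof
    assume "t n \<omega> \<le> s"
    then have "adaptive_em f g h X0 (\<lambda>r. W r \<omega>) n = stopped s n \<omega>"
      unfolding stopped_def t_def by (intro adaptive_em_local[where s=s] h_pos) auto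
    then show ?thesis ..
  next
    assume "fst (stopped s n \<omega>) \<le> s"
    then show ?thesis
      unfolding stopped_def by (intro adaptive_em_local[where s=s] h_pos) (auto simp: em_time_def)
  qed
  then show ?thesis by (simp add: t_def x_def em_time_def)
qed

text \<open>
  The cell fixes the rounded values of \<open>t\<^sub>n\<close> and \<open>t\<^bsub>n+1\<^esub>\<close> as grid points \<open>k\<close> and \<open>l\<close>. The second is shifted
  by one further grid step, which forces \<open>k < l\<close> on every nonempty cell and so avoids degenerate
  increments.
\<close>

definition in_cell :: "nat \<Rightarrow> nat \<Rightarrow> nat \<Rightarrow> real \<times> (real ^ 'm) \<Rightarrow> bool" where
  "in_cell j k l y \<longleftrightarrow> 0 \<le> fst y \<and> grid_index j (fst y) = k \<and> Suc (grid_index j (fst y + h (snd y))) = l"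

lemma in_cell_measurable [measurable]: "Measurable.pred (borel \<Otimes>\<^sub>M borel) (in_cell j k l)"
  unfolding in_cell_def[abs_def] by measurable

lemma stopped_cell:
  shows "in_cell j k l (stopped (grid j k) n \<omega>) \<longleftrightarrow> in_cell j k l (t n \<omega>, x n \<omega>)"
    and "in_cell j k l (t n \<omega>, x n \<omega>) \<Longrightarrow> stopped (grid j k) n \<omega> = (t n \<omega>, x n \<omega>)"
proof -
  let ?Y = "stopped (grid j k) n \<omega>"
  have Y: "?Y = (t n \<omega>, x n \<omega>)" if "in_cell j k l (t n \<omega>, x n \<omega>) \<or> in_cell j k l ?Y"
    using that
  proof (intro stopped_eq, elim disj_forward)
    assume "in_cell j k l ?Y"
    then show "fst ?Y \<le> grid j k"
      using grid_index_bounds(1)[of "fst ?Y" j] by (auto simp: in_cell_def)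
  next
    assume "in_cell j k l (t n \<omega>, x n \<omega>)"
    then show "t n \<omega> \<le> grid j k"
      using grid_index_bounds(1)[OF t_nonneg[of n \<omega>], of j] by (auto simp: in_cell_def)
  qed
  then show "in_cell j k l ?Y \<longleftrightarrow> in_cell j k l (t n \<omega>, x n \<omega>)" by metis
  show "in_cell j k l (t n \<omega>, x n \<omega>) \<Longrightarrow> ?Y = (t n \<omega>, x n \<omega>)" by (simp add: Y)
qed

text \<open>
  On a cell the increment is taken between two deterministic times, and all other quantities
  can be replaced by those of the stopped scheme, which are known at the first of these times.
  So the increment can be integrated out.
\<close>

lemma nn_integral_step_in_cell:
  fixes e :: "real \<times> (real ^ 'm) \<Rightarrow> ennreal"
  assumes e [measurable]: "e \<in> borel_measurable (borel \<Otimes>\<^sub>M borel)" and kl: "k < l"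
  shows "(\<integral>\<^sup>+\<omega>. (if in_cell j k l (t n \<omega>, x n \<omega>) then e (t n \<omega>, x n \<omega>) *
            energy K (em_step (x n \<omega>) (W (grid j l) \<omega> - W (grid j k) \<omega>)) else 0) \<partial>M)
    = (\<integral>\<^sup>+\<omega>. (if in_cell j k l (t n \<omega>, x n \<omega>) then e (t n \<omega>, x n \<omega>) *
            (\<integral>\<^sup>+z. gauss_density (grid j l - grid j k) z * ennreal (energy K (em_step (x n \<omega>) z)) \<partial>lborel) else 0) \<partial>M)"
proof -
  let ?Y = "stopped (grid j k) n" and ?y = "\<lambda>\<omega>. (t n \<omega>, x n \<omega>)"
  have sr: "0 \<le> grid j k" "grid j k < grid j l"
    using kl by (simp_all add: grid_nonneg) (simp add: grid_def divide_strict_right_mono)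
  define \<Psi> where "\<Psi> p = (if in_cell j k l (fst p) then e (fst p) * ennreal (energy K (em_step (snd (fst p)) (snd p))) else 0)"
    for p :: "(real \<times> (real ^ 'm)) \<times> (real ^ 'd)"
  have \<Psi>: "\<Psi> \<in> borel_measurable ((borel \<Otimes>\<^sub>M borel) \<Otimes>\<^sub>M borel)"
    unfolding \<Psi>_def[abs_def] by measurable
  have "(\<integral>\<^sup>+\<omega>. (if in_cell j k l (?y \<omega>) then e (?y \<omega>) *
            energy K (em_step (x n \<omega>) (W (grid j l) \<omega> - W (grid j k) \<omega>)) else 0) \<partial>M)
      = (\<integral>\<^sup>+\<omega>. \<Psi> (?Y \<omega>, W (grid j l) \<omega> - W (grid j k) \<omega>) \<partial>M)"
    using stopped_cell(2) by (intro nn_integral_cong) (auto simp: \<Psi>_def stopped_cell(1))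
  also have "\<dots> = (\<integral>\<^sup>+\<omega>. (\<integral>\<^sup>+z. gauss_density (grid j l - grid j k) z * \<Psi> (?Y \<omega>, z) \<partial>lborel) \<partial>M)"
    by (rule nn_integral_increment[OF sr stopped_measurable[OF sr(1)] \<Psi>])
  also have "\<dots> = (\<integral>\<^sup>+\<omega>. (if in_cell j k l (?y \<omega>) then e (?y \<omega>) *
            (\<integral>\<^sup>+z. gauss_density (grid j l - grid j k) z * ennreal (energy K (em_step (x n \<omega>) z)) \<partial>lborel) else 0) \<partial>M)"
  proof (rule nn_integral_cong)
    fix \<omega>
    show "(\<integral>\<^sup>+z. gauss_density (grid j l - grid j k) z * \<Psi> (?Y \<omega>, z) \<partial>lborel)
        = (if in_cell j k l (?y \<omega>) then e (?y \<omega>) *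
            (\<integral>\<^sup>+z. gauss_density (grid j l - grid j k) z * ennreal (energy K (em_step (x n \<omega>) z)) \<partial>lborel) else 0)"
    proof (cases "in_cell j k l (?y \<omega>)")
      case True
      have "(\<integral>\<^sup>+z. gauss_density (grid j l - grid j k) z * \<Psi> (?Y \<omega>, z) \<partial>lborel)
          = (\<integral>\<^sup>+z. e (?y \<omega>) * (gauss_density (grid j l - grid j k) z * ennreal (energy K (em_step (x n \<omega>) z))) \<partial>lborel)"
        using True stopped_cell(2)[OF True] by (simp add: \<Psi>_def mult_ac)
      then show ?thesis
        using True by (simp add: nn_integral_cmult)
    qed (simp add: \<Psi>_def stopped_cell(1))
  qed
  finally show ?thesis .
qed

text \<open>
  Summing the previous lemma over all cells. The weight \<open>e\<close> vanishes unless the step ends before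
  \<open>T\<close>; therefore timestep and variance are bounded, by \<open>T\<close> and \<open>T + 2\<close>, and the constant is uniform
  in \<open>n\<close>, in the mesh and in \<open>e\<close>. The variance exceeds the timestep by at most twice the mesh.
\<close>

lemma one_step_discretised:
  assumes T: "0 < T"
  obtains C where "0 \<le> C"
    "\<And>n j (e :: real \<times> (real ^ 'm) \<Rightarrow> ennreal).
      e \<in> borel_measurable (borel \<Otimes>\<^sub>M borel) \<Longrightarrow>
      (\<And>r y. 0 \<le> r \<Longrightarrow> T \<le> r + h y \<Longrightarrow> e (r, y) = 0) \<Longrightarrow>
      (\<integral>\<^sup>+\<omega>. e (t n \<omega>, x n \<omega>) * energy (k + 2) (em_step (x n \<omega>)
          (W (grid j (Suc (grid_index j (t (Suc n) \<omega>)))) \<omega> - W (grid j (grid_index j (t n \<omega>))) \<omega>)) \<partial>M)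
      \<le> (\<integral>\<^sup>+\<omega>. e (t n \<omega>, x n \<omega>) * ennreal (energy (k + 2) (x n \<omega>)
          * (1 + C * (h (x n \<omega>) + 1 / real (Suc j)))) \<partial>M)"
proof -
  have "0 \<le> T + 2" using T by simp
  from gaussian_lyapunov[OF c_nonneg this, where ?'m='m and ?'d='d and k=k]
  obtain C where C: "0 \<le> C" and step:
    "\<And>\<eta> v S (y :: real ^ 'm) (A :: real ^ 'd ^ 'm). 0 \<le> \<eta> \<Longrightarrow> \<eta> \<le> T + 2 \<Longrightarrow> 0 < v \<Longrightarrow> v \<le> T + 2 \<Longrightarrow> 1 \<le> S \<Longrightarrow>
      1 + (norm y)\<^sup>2 \<le> S * (1 + c * \<eta>) \<Longrightarrow> (norm A)\<^sup>2 \<le> S * c \<Longrightarrow>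
      (\<integral>\<^sup>+z. gauss_density v (z :: real ^ 'd) \<partial>lborel) = 1 \<Longrightarrow>
      (\<integral>\<^sup>+z. gauss_density (2 * v) (z :: real ^ 'd) \<partial>lborel) = 1 \<Longrightarrow>
      (\<integral>\<^sup>+z. gauss_density v z * ennreal ((1 + (norm (y + A *v z))\<^sup>2) ^ (k + 2)) \<partial>lborel)
        \<le> ennreal (S ^ (k + 2) * (1 + C * (\<eta> + v)))"
    by blast
  show ?thesis
  proof (rule that)
    show "0 \<le> 2 * C" using C by simp
    fix n j :: nat and e :: "real \<times> (real ^ 'm) \<Rightarrow> ennreal"
    assume e [measurable]: "e \<in> borel_measurable (borel \<Otimes>\<^sub>M borel)"
      and e_zero: "\<And>r y. 0 \<le> r \<Longrightarrow> T \<le> r + h y \<Longrightarrow> e (r, y) = 0"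
    define J where "J = 1 / real (Suc j)"
    have J: "0 < J" "J \<le> 1" by (simp_all add: J_def)
    have grid_Suc: "grid j (Suc i) = grid j i + J" for i
      by (simp add: grid_def J_def add_divide_distrib)
    let ?y = "\<lambda>\<omega>. (t n \<omega>, x n \<omega>)"
    let ?k = "\<lambda>\<omega>. grid_index j (t n \<omega>)" and ?l = "\<lambda>\<omega>. Suc (grid_index j (t (Suc n) \<omega>))"
    let ?u = "\<lambda>\<omega>. e (?y \<omega>) * ennreal (energy (k + 2) (em_step (x n \<omega>) (W (grid j (?l \<omega>)) \<omega> - W (grid j (?k \<omega>)) \<omega>)))"
    let ?Q = "\<lambda>\<omega>. energy (k + 2) (x n \<omega>) * (1 + 2 * C * (h (x n \<omega>) + J))"
    let ?v = "\<lambda>\<omega>. e (?y \<omega>) * ennreal (?Q \<omega>)"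
    have cell: "(?k \<omega>, ?l \<omega>) = (k', l') \<longleftrightarrow> in_cell j k' l' (?y \<omega>)" for k' l' \<omega>
      by (simp add: in_cell_def t_Suc t_nonneg)
    have "(\<integral>\<^sup>+\<omega>. ?u \<omega> \<partial>M) \<le> (\<integral>\<^sup>+\<omega>. ?v \<omega> \<partial>M)"
    proof (rule nn_integral_mono_on_countable_partition)
      have [measurable]: "?k \<in> M \<rightarrow>\<^sub>M count_space UNIV" "?l \<in> M \<rightarrow>\<^sub>M count_space UNIV"
        by measurable
      show "(\<lambda>\<omega>. (?k \<omega>, ?l \<omega>)) \<in> M \<rightarrow>\<^sub>M count_space UNIV"
        by measurable
      have [measurable]: "(\<lambda>\<omega>. W (grid j (?k \<omega>)) \<omega>) \<in> borel_measurable M"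
        "(\<lambda>\<omega>. W (grid j (?l \<omega>)) \<omega>) \<in> borel_measurable M"
        by (rule measurable_compose_countable[where f="\<lambda>i. W (grid j i)"]; simp add: W_measurable grid_nonneg)+
      show "?u \<in> borel_measurable M" "?v \<in> borel_measurable M"
        by measurable
      fix i :: "nat \<times> nat"
      obtain k' l' where i: "i = (k', l')" by (cases i)
      let ?s = "grid j k'" and ?r = "grid j l'"
      let ?cell = "\<lambda>\<omega>. in_cell j k' l' (?y \<omega>)"
      have "(\<integral>\<^sup>+\<omega>. (if ?cell \<omega> then ?u \<omega> else 0) \<partial>M) \<le> (\<integral>\<^sup>+\<omega>. (if ?cell \<omega> then ?v \<omega> else 0) \<partial>M)"
      proof (cases "k' < l'")
        case False
        have "\<not> ?cell \<omega>" for \<omega>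
        proof -
          have "t n \<omega> \<le> t n \<omega> + h (x n \<omega>)" using h_pos[of "x n \<omega>"] by simp
          from grid_index_mono[OF this, of j] False show ?thesis by (auto simp: in_cell_def)
        qed
        then show ?thesis by simp
      next
        case True
        then have sr: "?s < ?r"
          by (simp add: grid_def divide_strict_right_mono)
        have "(\<integral>\<^sup>+\<omega>. (if ?cell \<omega> then ?u \<omega> else 0) \<partial>M)
            = (\<integral>\<^sup>+\<omega>. (if ?cell \<omega> then e (?y \<omega>) * energy (k + 2) (em_step (x n \<omega>) (W ?r \<omega> - W ?s \<omega>)) else 0) \<partial>M)"
          by (intro nn_integral_cong) (auto simp: in_cell_def t_Suc)
        also have "\<dots> = (\<integral>\<^sup>+\<omega>. (if ?cell \<omega> then e (?y \<omega>) *
            (\<integral>\<^sup>+z. gauss_density (?r - ?s) z * ennreal (energy (k + 2) (em_step (x n \<omega>) z)) \<partial>lborel) else 0) \<partial>M)"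
          by (rule nn_integral_step_in_cell[OF e True])
        also have "\<dots> \<le> (\<integral>\<^sup>+\<omega>. (if ?cell \<omega> then ?v \<omega> else 0) \<partial>M)"
        proof (rule nn_integral_mono)
          fix \<omega>
          show "(if ?cell \<omega> then e (?y \<omega>) *
              (\<integral>\<^sup>+z. gauss_density (?r - ?s) z * ennreal (energy (k + 2) (em_step (x n \<omega>) z)) \<partial>lborel) else 0)
            \<le> (if ?cell \<omega> then ?v \<omega> else 0)"
          proof (cases "?cell \<omega> \<and> t n \<omega> + h (x n \<omega>) < T")
            case False
            then show ?thesis using e_zero[of "t n \<omega>" "x n \<omega>"] t_nonneg[of n \<omega>] by auto
          next
            case True
            then have h: "0 \<le> h (x n \<omega>)" "h (x n \<omega>) \<le> T"
              using h_pos[of "x n \<omega>"] t_nonneg[of n \<omega>] by auto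
            have "t n \<omega> \<le> ?s" "?r \<le> t n \<omega> + h (x n \<omega>) + 2 * J"
              using True grid_index_bounds[of "t n \<omega>" j] h t_nonneg[of n \<omega>]
                grid_index_bounds[of "t n \<omega> + h (x n \<omega>)" j, folded J_def]
              by (auto simp: in_cell_def grid_Suc)
            then have v: "0 < ?r - ?s" "?r - ?s \<le> h (x n \<omega>) + 2 * J" using sr by auto
            have "(\<integral>\<^sup>+z. gauss_density (?r - ?s) z * ennreal (energy (k + 2) (em_step (x n \<omega>) z)) \<partial>lborel)
                \<le> ennreal ((1 + (norm (x n \<omega>))\<^sup>2) ^ (k + 2) * (1 + C * (h (x n \<omega>) + (?r - ?s))))"
              unfolding energy_def em_step_def using h v J T
              by (intro step drift_growth diffusion_growth gauss_density_total) auto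
            also have "\<dots> \<le> ennreal (?Q \<omega>)"
            proof (intro ennreal_leI)
              have "h (x n \<omega>) + (?r - ?s) \<le> 2 * (h (x n \<omega>) + J)" using v by simp
              from mult_left_mono[OF this C]
              show "(1 + (norm (x n \<omega>))\<^sup>2) ^ (k + 2) * (1 + C * (h (x n \<omega>) + (?r - ?s))) \<le> ?Q \<omega>"
                unfolding energy_def by (intro mult_left_mono) (auto simp: mult_ac)
            qed
            finally show ?thesis
              by (simp add: mult_left_mono)
          qed
        qed
        finally show ?thesis .
      qed
      then show "(\<integral>\<^sup>+\<omega>. (if (?k \<omega>, ?l \<omega>) = i then ?u \<omega> else 0) \<partial>M)
          \<le> (\<integral>\<^sup>+\<omega>. (if (?k \<omega>, ?l \<omega>) = i then ?v \<omega> else 0) \<partial>M)"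
        unfolding i cell .
    qed
    then show "(\<integral>\<^sup>+\<omega>. ?u \<omega> \<partial>M)
      \<le> (\<integral>\<^sup>+\<omega>. e (?y \<omega>) * ennreal (energy (k + 2) (x n \<omega>)
          * (1 + 2 * C * (h (x n \<omega>) + 1 / real (Suc j)))) \<partial>M)"
      by (simp only: J_def)
  qed
qed

text \<open>
  Fatou's lemma as the mesh tends to zero. Finiteness of the weighted moment at step \<open>n\<close> makes the
  error term proportional to the mesh vanish.
\<close>

lemma one_step_moment:
  assumes T: "0 < T"
  obtains C where "0 \<le> C"
    "\<And>n (e :: real \<times> (real ^ 'm) \<Rightarrow> ennreal).
      e \<in> borel_measurable (borel \<Otimes>\<^sub>M borel) \<Longrightarrow> (\<And>y. e y < \<infinity>) \<Longrightarrow>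
      (\<And>r y. 0 \<le> r \<Longrightarrow> T \<le> r + h y \<Longrightarrow> e (r, y) = 0) \<Longrightarrow>
      (\<integral>\<^sup>+\<omega>. e (t n \<omega>, x n \<omega>) * ennreal (energy (k + 2) (x n \<omega>)) \<partial>M) < \<infinity> \<Longrightarrow>
      (\<integral>\<^sup>+\<omega>. e (t n \<omega>, x n \<omega>) * ennreal (energy (k + 2) (x (Suc n) \<omega>)) \<partial>M)
      \<le> (\<integral>\<^sup>+\<omega>. e (t n \<omega>, x n \<omega>) * ennreal (energy (k + 2) (x n \<omega>) * (1 + C * h (x n \<omega>))) \<partial>M)"
proof -
  obtain C where C: "0 \<le> C" and discretised: "\<And>n j (e :: real \<times> (real ^ 'm) \<Rightarrow> ennreal).
      e \<in> borel_measurable (borel \<Otimes>\<^sub>M borel) \<Longrightarrow>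
      (\<And>r y. 0 \<le> r \<Longrightarrow> T \<le> r + h y \<Longrightarrow> e (r, y) = 0) \<Longrightarrow>
      (\<integral>\<^sup>+\<omega>. e (t n \<omega>, x n \<omega>) * energy (k + 2) (em_step (x n \<omega>)
          (W (grid j (Suc (grid_index j (t (Suc n) \<omega>)))) \<omega> - W (grid j (grid_index j (t n \<omega>))) \<omega>)) \<partial>M)
      \<le> (\<integral>\<^sup>+\<omega>. e (t n \<omega>, x n \<omega>) * ennreal (energy (k + 2) (x n \<omega>)
          * (1 + C * (h (x n \<omega>) + 1 / real (Suc j)))) \<partial>M)"
    using one_step_discretised[OF T, of k] by blast
  show ?thesis
  proof (rule that[OF C])
    fix n and e :: "real \<times> (real ^ 'm) \<Rightarrow> ennreal"
    assume e [measurable]: "e \<in> borel_measurable (borel \<Otimes>\<^sub>M borel)" and e_fin: "\<And>y. e y < \<infinity>"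
      and e_zero: "\<And>r y. 0 \<le> r \<Longrightarrow> T \<le> r + h y \<Longrightarrow> e (r, y) = 0"
      and fin: "(\<integral>\<^sup>+\<omega>. e (t n \<omega>, x n \<omega>) * ennreal (energy (k + 2) (x n \<omega>)) \<partial>M) < \<infinity>"
    let ?E = "\<lambda>\<omega>. e (t n \<omega>, x n \<omega>)" and ?V = "\<lambda>\<omega>. energy (k + 2) (x n \<omega>)"
    let ?\<Delta> = "\<lambda>j \<omega>. W (grid j (Suc (grid_index j (t (Suc n) \<omega>)))) \<omega> - W (grid j (grid_index j (t n \<omega>))) \<omega>"
    let ?u = "\<lambda>j \<omega>. ?E \<omega> * ennreal (energy (k + 2) (em_step (x n \<omega>) (?\<Delta> j \<omega>)))"
    let ?A = "\<integral>\<^sup>+\<omega>. ?E \<omega> * ennreal (?V \<omega> * (1 + C * h (x n \<omega>))) \<partial>M"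
    let ?B = "\<integral>\<^sup>+\<omega>. ?E \<omega> * ennreal (?V \<omega>) \<partial>M"
    have V_nonneg: "0 \<le> ?V \<omega>" for \<omega>
      using energy_ge_1[of "k + 2" "x n \<omega>"] by simp
    have lim: "(\<lambda>j. ?u j \<omega>) \<longlonglongrightarrow> ?E \<omega> * ennreal (energy (k + 2) (x (Suc n) \<omega>))" if "\<omega> \<in> space M" for \<omega>
    proof -
      have incr: "(\<lambda>j. ?\<Delta> j \<omega>) \<longlonglongrightarrow> W (t (Suc n) \<omega>) \<omega> - W (t n \<omega>) \<omega>"
        by (intro tendsto_diff continuous_on_tendsto_compose[OF continuous_paths[OF that]] tendsto_grid t_nonneg)
           (auto simp: grid_nonneg t_nonneg)
      have cont: "continuous_on UNIV (\<lambda>z. energy (k + 2) (em_step (x n \<omega>) z))"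
        unfolding energy_def em_step_def
        by (intro continuous_intros matrix_vector_mult_linear_continuous_on)
      have "(\<lambda>j. energy (k + 2) (em_step (x n \<omega>) (?\<Delta> j \<omega>))) \<longlonglongrightarrow> energy (k + 2) (x (Suc n) \<omega>)"
        unfolding x_Suc by (rule continuous_on_tendsto_compose[OF cont incr]) simp_all
      then show ?thesis
        using e_fin by (intro ennreal_tendsto_cmult tendsto_ennrealI) simp_all
    qed
    have u_meas [measurable]: "?u j \<in> borel_measurable M" for j
    proof -
      have [measurable]: "(\<lambda>\<omega>. W (grid j (grid_index j (t n \<omega>))) \<omega>) \<in> borel_measurable M"
        "(\<lambda>\<omega>. W (grid j (Suc (grid_index j (t (Suc n) \<omega>)))) \<omega>) \<in> borel_measurable M"
        by (rule measurable_compose_countable[where f="\<lambda>i. W (grid j i)"]; simp add: W_measurable grid_nonneg)+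
      show ?thesis by measurable
    qed
    have le: "(\<integral>\<^sup>+\<omega>. ?u j \<omega> \<partial>M) \<le> ?A + ?B * ennreal (C * (1 / real (Suc j)))" for j
    proof -
      have "(\<integral>\<^sup>+\<omega>. ?u j \<omega> \<partial>M) \<le> (\<integral>\<^sup>+\<omega>. ?E \<omega> * ennreal (?V \<omega> * (1 + C * (h (x n \<omega>) + 1 / real (Suc j)))) \<partial>M)"
        by (rule discretised[OF e e_zero])
      also have "\<dots> = (\<integral>\<^sup>+\<omega>. ?E \<omega> * ennreal (?V \<omega> * (1 + C * h (x n \<omega>)))
          + ?E \<omega> * ennreal (?V \<omega>) * ennreal (C * (1 / real (Suc j))) \<partial>M)"
      proof (rule nn_integral_cong)
        fix \<omega>
        have "?V \<omega> * (1 + C * (h (x n \<omega>) + 1 / real (Suc j)))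
            = ?V \<omega> * (1 + C * h (x n \<omega>)) + ?V \<omega> * (C * (1 / real (Suc j)))"
          by (simp add: algebra_simps)
        moreover have "0 \<le> ?V \<omega> * (1 + C * h (x n \<omega>))" "0 \<le> C * (1 / real (Suc j))"
          using C V_nonneg[of \<omega>] less_imp_le[OF h_pos, of "x n \<omega>"] by simp_all
        ultimately show "?E \<omega> * ennreal (?V \<omega> * (1 + C * (h (x n \<omega>) + 1 / real (Suc j))))
            = ?E \<omega> * ennreal (?V \<omega> * (1 + C * h (x n \<omega>))) + ?E \<omega> * ennreal (?V \<omega>) * ennreal (C * (1 / real (Suc j)))"
          using V_nonneg[of \<omega>]
          by (simp only: ennreal_plus ennreal_mult distrib_left mult.assoc mult_nonneg_nonneg)
      qed
      also have "\<dots> = ?A + ?B * ennreal (C * (1 / real (Suc j)))"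
        by (simp add: nn_integral_add nn_integral_multc)
      finally show ?thesis .
    qed
    have "(\<lambda>j. C * (1 / real (Suc j))) \<longlonglongrightarrow> C * 0"
      by (intro tendsto_mult_left) (use LIMSEQ_inverse_real_of_nat in \<open>simp add: inverse_eq_divide\<close>)
    then have "(\<lambda>j. ?B * ennreal (C * (1 / real (Suc j)))) \<longlonglongrightarrow> ?B * ennreal (C * 0)"
      using fin by (intro ennreal_tendsto_cmult tendsto_ennrealI) simp_all
    then have bound_lim: "(\<lambda>j. ?A + ?B * ennreal (C * (1 / real (Suc j)))) \<longlonglongrightarrow> ?A"
      using tendsto_add[OF tendsto_const, of _ 0 sequentially ?A] by simp
    have "(\<integral>\<^sup>+\<omega>. ?E \<omega> * ennreal (energy (k + 2) (x (Suc n) \<omega>)) \<partial>M) = (\<integral>\<^sup>+\<omega>. liminf (\<lambda>j. ?u j \<omega>) \<partial>M)"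
      by (rule nn_integral_cong) (rule lim_imp_Liminf[symmetric, OF sequentially_bot lim])
    also have "\<dots> \<le> liminf (\<lambda>j. \<integral>\<^sup>+\<omega>. ?u j \<omega> \<partial>M)"
      by (rule nn_integral_liminf[OF u_meas])
    also have "\<dots> \<le> liminf (\<lambda>j. ?A + ?B * ennreal (C * (1 / real (Suc j))))"
      by (rule Liminf_mono) (simp only: le eventually_True)
    also have "\<dots> = ?A"
      by (rule lim_imp_Liminf[OF _ bound_lim]) simp
    finally show "(\<integral>\<^sup>+\<omega>. ?E \<omega> * ennreal (energy (k + 2) (x (Suc n) \<omega>)) \<partial>M) \<le> ?A" .
  qed
qed

section \<open>Discounted moments along the scheme\<close>

text \<open>
  Discounting at rate \<open>C + 1\<close> beats the growth factor \<open>1 + C \<eta> \<le> exp (C \<eta>)\<close> by the factor \<open>exp (- \<eta>)\<close>,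
  which for \<open>\<eta> < T\<close> leaves a surplus linear in \<open>\<eta>\<close>.
\<close>

lemma discounted_growth_le:
  fixes \<eta> T C s :: real
  assumes "0 \<le> \<eta>" "\<eta> < T" "s < T" "0 \<le> C"
  shows "exp (- (C + 1) * (s + \<eta>)) * (1 + C * \<eta>) + exp (- (C + 1) * T) / (1 + T) * \<eta> \<le> exp (- (C + 1) * s)"
proof -
  have "exp (- (C + 1) * (s + \<eta>)) * (1 + C * \<eta>) \<le> exp (- (C + 1) * (s + \<eta>)) * exp (C * \<eta>)"
    using assms by (intro mult_left_mono exp_ge_add_one_self) auto
  also have "\<dots> = exp (- (C + 1) * s) * exp (- \<eta>)"
    by (simp add: exp_add[symmetric] algebra_simps)
  also have "exp (- \<eta>) \<le> 1 / (1 + \<eta>)"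
    using exp_ge_add_one_self[of \<eta>] assms by (simp add: exp_minus field_simps)
  also have "1 / (1 + \<eta>) = 1 - \<eta> / (1 + \<eta>)"
    using assms by (simp add: field_simps)
  also have "\<dots> \<le> 1 - \<eta> / (1 + T)"
    using assms by (intro diff_left_mono divide_left_mono) auto
  finally have 1: "exp (- (C + 1) * (s + \<eta>)) * (1 + C * \<eta>) \<le> exp (- (C + 1) * s) * (1 - \<eta> / (1 + T))"
    by simp
  have "exp (- (C + 1) * T) * (\<eta> / (1 + T)) \<le> exp (- (C + 1) * s) * (\<eta> / (1 + T))"
    using assms by (intro mult_right_mono) auto
  with 1 show ?thesis by (simp add: algebra_simps)
qed

text \<open>
  The discounted moments \<open>u n\<close> on the event \<open>t\<^sub>n < T\<close> decrease by at least \<open>\<kappa>\<close> times the \<open>n\<close>-th term of the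
  series, so the partial sums are bounded by \<open>u 0 / \<kappa>\<close>.
\<close>

lemma summable_weighted_moments:
  assumes T: "0 < T"
  shows "(\<Sum>n. \<integral>\<^sup>+\<omega>. (if t (Suc n) \<omega> < T then ennreal (h (x n \<omega>) * energy (k + 2) (x n \<omega>)) else 0) \<partial>M) < \<infinity>"
proof -
  obtain C where C: "0 \<le> C" and one_step: "\<And>n (e :: real \<times> (real ^ 'm) \<Rightarrow> ennreal).
      e \<in> borel_measurable (borel \<Otimes>\<^sub>M borel) \<Longrightarrow> (\<And>y. e y < \<infinity>) \<Longrightarrow>
      (\<And>r y. 0 \<le> r \<Longrightarrow> T \<le> r + h y \<Longrightarrow> e (r, y) = 0) \<Longrightarrow>
      (\<integral>\<^sup>+\<omega>. e (t n \<omega>, x n \<omega>) * ennreal (energy (k + 2) (x n \<omega>)) \<partial>M) < \<infinity> \<Longrightarrow>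
      (\<integral>\<^sup>+\<omega>. e (t n \<omega>, x n \<omega>) * ennreal (energy (k + 2) (x (Suc n) \<omega>)) \<partial>M)
      \<le> (\<integral>\<^sup>+\<omega>. e (t n \<omega>, x n \<omega>) * ennreal (energy (k + 2) (x n \<omega>) * (1 + C * h (x n \<omega>))) \<partial>M)"
    using one_step_moment[OF T, of k] by blast
  define D where "D s = exp (- (C + 1) * s)" for s
  define \<kappa> where "\<kappa> = D T / (1 + T)"
  have D: "0 < D s" for s by (simp add: D_def)
  have [measurable]: "D \<in> borel_measurable borel" unfolding D_def[abs_def] by measurable
  have \<kappa>: "0 < \<kappa>" using T D[of T] by (simp add: \<kappa>_def)
  define V where "V n \<omega> = energy (k + 2) (x n \<omega>)" for n \<omega>
  have V: "0 \<le> V n \<omega>" for n \<omega>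
    using energy_ge_1[of "k + 2" "x n \<omega>"] by (simp add: V_def)
  have [measurable]: "V n \<in> borel_measurable M" for n unfolding V_def[abs_def] by measurable
  define u where "u n = (\<integral>\<^sup>+\<omega>. (if t n \<omega> < T then ennreal (D (t n \<omega>) * V n \<omega>) else 0) \<partial>M)" for n
  define I where "I n = (\<integral>\<^sup>+\<omega>. (if t (Suc n) \<omega> < T then ennreal (h (x n \<omega>) * V n \<omega>) else 0) \<partial>M)" for n
  \<comment> \<open>The discount at the end of the step, restricted to steps that end before \<open>T\<close>; both are functions of \<open>(t\<^sub>n, X\<^sub>n)\<close>.\<close>
  define e where "e y = (if fst y + h (snd y) < T then ennreal (D (fst y + h (snd y))) else 0)" for y :: "real \<times> (real ^ 'm)"
  have e_meas: "e \<in> borel_measurable (borel \<Otimes>\<^sub>M borel)" unfolding e_def[abs_def] by measurable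
  have step: "u (Suc n) + ennreal \<kappa> * I n \<le> u n" if "u n < \<infinity>" for n
  proof -
    have e_t: "e (t n \<omega>, x n \<omega>) = (if t (Suc n) \<omega> < T then ennreal (D (t (Suc n) \<omega>)) else 0)" for \<omega>
      by (simp add: e_def t_Suc)
    have h: "0 < h (x n \<omega>)" "h (x n \<omega>) < T" "t n \<omega> < T" if "t (Suc n) \<omega> < T" for \<omega>
      using that h_pos[of "x n \<omega>"] t_nonneg[of n \<omega>] by (auto simp: t_Suc)
    have D_le: "D (t (Suc n) \<omega>) * (1 + C * h (x n \<omega>)) + \<kappa> * h (x n \<omega>) \<le> D (t n \<omega>)" if "t (Suc n) \<omega> < T" for \<omega>
      using discounted_growth_le[of "h (x n \<omega>)" T "t n \<omega>" C] h[OF that] C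
      by (simp add: D_def \<kappa>_def t_Suc)
    have "(\<integral>\<^sup>+\<omega>. e (t n \<omega>, x n \<omega>) * ennreal (energy (k + 2) (x n \<omega>)) \<partial>M) \<le> u n"
      unfolding u_def
    proof (rule nn_integral_mono)
      fix \<omega>
      have "D (t (Suc n) \<omega>) \<le> D (t n \<omega>)"
        using C h_pos[of "x n \<omega>"] by (simp add: D_def t_Suc)
      then show "e (t n \<omega>, x n \<omega>) * ennreal (energy (k + 2) (x n \<omega>))
          \<le> (if t n \<omega> < T then ennreal (D (t n \<omega>) * V n \<omega>) else 0)"
        using h(3)[of \<omega>] V[of n \<omega>] D[of "t (Suc n) \<omega>"] unfolding e_t V_def[symmetric]
        by (auto simp: ennreal_mult'[symmetric] intro!: ennreal_leI mult_right_mono)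
    qed
    also note that
    finally have fin: "(\<integral>\<^sup>+\<omega>. e (t n \<omega>, x n \<omega>) * ennreal (energy (k + 2) (x n \<omega>)) \<partial>M) < \<infinity>" .
    have "u (Suc n) = (\<integral>\<^sup>+\<omega>. e (t n \<omega>, x n \<omega>) * ennreal (energy (k + 2) (x (Suc n) \<omega>)) \<partial>M)"
      unfolding u_def e_t V_def[symmetric]
      by (intro nn_integral_cong) (use less_imp_le[OF D] in \<open>simp add: ennreal_mult'\<close>)
    also have "\<dots> \<le> (\<integral>\<^sup>+\<omega>. e (t n \<omega>, x n \<omega>) * ennreal (energy (k + 2) (x n \<omega>) * (1 + C * h (x n \<omega>))) \<partial>M)"
      by (rule one_step[OF e_meas _ _ fin]) (auto simp: e_def)
    finally have "u (Suc n) + ennreal \<kappa> * I n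
        \<le> (\<integral>\<^sup>+\<omega>. e (t n \<omega>, x n \<omega>) * ennreal (V n \<omega> * (1 + C * h (x n \<omega>))) \<partial>M) + ennreal \<kappa> * I n"
      unfolding V_def by (rule add_right_mono)
    also have "\<dots> = (\<integral>\<^sup>+\<omega>. e (t n \<omega>, x n \<omega>) * ennreal (V n \<omega> * (1 + C * h (x n \<omega>)))
        + ennreal \<kappa> * (if t (Suc n) \<omega> < T then ennreal (h (x n \<omega>) * V n \<omega>) else 0) \<partial>M)"
      unfolding I_def using e_meas by (simp add: nn_integral_add nn_integral_cmult)
    also have "\<dots> \<le> u n"
      unfolding u_def
    proof (rule nn_integral_mono)
      fix \<omega>
      show "e (t n \<omega>, x n \<omega>) * ennreal (V n \<omega> * (1 + C * h (x n \<omega>)))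
            + ennreal \<kappa> * (if t (Suc n) \<omega> < T then ennreal (h (x n \<omega>) * V n \<omega>) else 0)
          \<le> (if t n \<omega> < T then ennreal (D (t n \<omega>) * V n \<omega>) else 0)"
      proof (cases "t (Suc n) \<omega> < T")
        case True
        have "D (t (Suc n) \<omega>) * (V n \<omega> * (1 + C * h (x n \<omega>))) + \<kappa> * (h (x n \<omega>) * V n \<omega>)
            = (D (t (Suc n) \<omega>) * (1 + C * h (x n \<omega>)) + \<kappa> * h (x n \<omega>)) * V n \<omega>"
          by (simp add: algebra_simps)
        also have "\<dots> \<le> D (t n \<omega>) * V n \<omega>"
          by (rule mult_right_mono[OF D_le[OF True] V])
        finally show ?thesis
          using True h[OF True] V[of n \<omega>] D[of "t (Suc n) \<omega>"] \<kappa> C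
          by (simp add: e_t ennreal_mult'[symmetric] ennreal_plus[symmetric] ennreal_leI del: ennreal_plus)
      qed (simp add: e_t)
    qed
    finally show ?thesis .
  qed
  have "ennreal (D 0 * energy (k + 2) X0) < \<infinity>" by simp
  then have u0: "u 0 < \<infinity>"
    using T by (simp add: u_def t_0 V_def x_0 emeasure_space_1)
  have "u N + (\<Sum>n<N. ennreal \<kappa> * I n) \<le> u 0" for N
  proof (induction N)
    case (Suc N)
    have "u N \<le> u N + (\<Sum>n<N. ennreal \<kappa> * I n)"
      by simp
    with Suc.IH u0 have "u N < \<infinity>" by (meson le_less_trans)
    then have "u (Suc N) + ennreal \<kappa> * I N + (\<Sum>n<N. ennreal \<kappa> * I n) \<le> u N + (\<Sum>n<N. ennreal \<kappa> * I n)"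
      by (intro add_right_mono step)
    also note Suc.IH
    finally show ?case by (simp add: ac_simps)
  qed simp
  then have "(\<Sum>n<N. ennreal \<kappa> * I n) \<le> u 0" for N
    by (meson add_increasing order_trans zero_le order_refl)
  then have "(\<Sum>n. ennreal \<kappa> * I n) \<le> u 0"
    unfolding suminf_eq_SUP by (rule SUP_least)
  then have "ennreal \<kappa> * (\<Sum>n. I n) < \<infinity>"
    using u0 by simp
  then have "(\<Sum>n. I n) < \<infinity>"
    using \<kappa> by (auto simp: ennreal_mult_less_top)
  then show ?thesis unfolding I_def V_def .
qed

end

section \<open>From weighted moments to the number of steps\<close>

lemma young_power:
  fixes a b :: real
  assumes "0 \<le> a" "0 < b"
  shows "a \<le> b + a ^ Suc P / b ^ P"
proof (cases "a \<le> b")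
  case True
  then show ?thesis using assms by (simp add: add_increasing2)
next
  case False
  then have "a * b ^ P \<le> a * a ^ P"
    using assms by (intro mult_left_mono power_mono) auto
  then have "a \<le> a ^ Suc P / b ^ P"
    using assms by (simp add: field_simps)
  with assms show ?thesis by simp
qed

text \<open>
  Jensen's inequality for the weights \<open>h\<close> on the first \<open>K\<close> steps, whose sum is less than \<open>T\<close>, applied to
  \<open>1 / h\<close>. It is obtained from \<open>young_power\<close>, with \<open>b\<close> chosen such that the term \<open>b T\<close> is half of \<open>K\<close>
  and can be absorbed on the left.
\<close>

lemma step_count_power_le:
  assumes h: "\<And>x. h x > 0" and T: "0 < T" and D: "\<And>x. (1 / h x) ^ Suc P \<le> D * energy k x"
    and K: "em_time f g h X0 w K < T"
  shows "real K ^ Suc P \<le> 2 * (2 * T) ^ P * D *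
    (\<Sum>j<K. h (em_pos f g h X0 w j) * energy k (em_pos f g h X0 w j))"
proof (cases "K = 0")
  case False
  let ?x = "em_pos f g h X0 w"
  let ?S = "\<Sum>j<K. h (?x j) * energy k (?x j)"
  \<comment> \<open>The \<open>h\<close>-weighted sum of the constant \<open>b\<close> is then at most \<open>K / 2\<close>.\<close>
  define b where "b = real K / (2 * T)"
  have b: "0 < b" using False T by (simp add: b_def)
  have time: "em_time f g h X0 w n = (\<Sum>j<n. h (?x j))" for n
    by (induction n) (simp_all add: em_time_Suc)
  have "1 \<le> b * h (?x j) + D / b ^ P * (h (?x j) * energy k (?x j))" for j
  proof -
    have "1 / h (?x j) \<le> b + (1 / h (?x j)) ^ Suc P / b ^ P"
      using h[of "?x j"] b by (intro young_power) auto
    also have "\<dots> \<le> b + D * energy k (?x j) / b ^ P"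
      using D b by (intro add_left_mono divide_right_mono) auto
    finally show ?thesis
      using h[of "?x j"] by (simp add: field_simps)
  qed
  then have "(\<Sum>j<K. 1) \<le> (\<Sum>j<K. b * h (?x j) + D / b ^ P * (h (?x j) * energy k (?x j)))"
    by (intro sum_mono)
  also have "\<dots> = b * em_time f g h X0 w K + D / b ^ P * ?S"
    by (simp add: time sum.distrib sum_distrib_left)
  also have "\<dots> \<le> b * T + D / b ^ P * ?S"
    using K b by simp
  also have "b * T = real K / 2"
    using T by (simp add: b_def)
  finally have "real K / 2 * b ^ P \<le> D * ?S"
    using b by (simp add: field_simps)
  then have "2 * (2 * T) ^ P * (real K / 2 * b ^ P) \<le> 2 * (2 * T) ^ P * (D * ?S)"
    using T by (intro mult_left_mono) auto
  moreover have "2 * (2 * T) ^ P * (real K / 2 * b ^ P) = real K ^ Suc P"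
    using T by (simp add: b_def power_divide power_mult_distrib)
  ultimately show ?thesis by (simp only: mult.assoc)
qed simp

text \<open>
  If \<open>T\<close> is never reached, then the previous bound holds for every number of steps, the series
  diverges and the right-hand side is infinite.
\<close>

lemma enat_powr_num_steps_le:
  assumes h: "\<And>x. h x > 0" and T: "0 < T" and D: "\<And>x. (1 / h x) ^ Suc P \<le> D * energy k x"
    and p: "0 < p" "p \<le> real (Suc P)" and D_nonneg: "0 \<le> D"
  shows "enat_powr (num_steps f g h X0 T w) p \<le> ennreal (2 ^ Suc P) * (1 + ennreal (2 * (2 * T) ^ P * D) *
    (\<Sum>n. if em_time f g h X0 w (Suc n) < T
      then ennreal (h (em_pos f g h X0 w n) * energy k (em_pos f g h X0 w n)) else 0))"
    (is "_ \<le> _ * (1 + ennreal ?C * ?G)")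
proof -
  let ?t = "em_time f g h X0 w" and ?x = "em_pos f g h X0 w"
  let ?a = "\<lambda>j. h (?x j) * energy k (?x j)"
  have a: "0 \<le> ?a j" for j
    using h[of "?x j"] energy_ge_1[of k "?x j"] by simp
  have C: "0 \<le> ?C" using T D_nonneg by simp
  have bound: "ennreal (real K ^ Suc P) \<le> ennreal ?C * ?G" if K: "?t K < T" for K
  proof -
    have "real K ^ Suc P \<le> ?C * (\<Sum>j<K. ?a j)"
      by (rule step_count_power_le[OF h T D K])
    then have "ennreal (real K ^ Suc P) \<le> ennreal ?C * ennreal (\<Sum>j<K. ?a j)"
      using C by (simp add: ennreal_mult'[symmetric] ennreal_leI)
    also have "ennreal (\<Sum>j<K. ?a j) = (\<Sum>j<K. if ?t (Suc j) < T then ennreal (?a j) else 0)"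
    proof -
      have "?t (Suc j) < T" if "j < K" for j
        using that em_time_mono[of h "Suc j" K f g X0 w] h K by auto
      then show ?thesis
        using a by (subst sum_ennreal[symmetric]) auto
    qed
    also have "\<dots> \<le> ?G"
      by (rule sum_le_suminf) auto
    finally show ?thesis by (simp add: mult_left_mono)
  qed
  show ?thesis
  proof (cases "\<exists>n. T \<le> ?t n")
    case True
    define N where "N = (LEAST n. T \<le> ?t n)"
    have N: "num_steps f g h X0 T w = enat N"
      using True by (simp add: num_steps_def N_def)
    have "T \<le> ?t N" using True unfolding N_def by (rule LeastI_ex)
    then have "N \<noteq> 0" using T by (metis em_time_0 not_le)
    then obtain K where K: "N = Suc K" by (cases N) auto
    then have "?t K < T" using not_less_Least[of K "\<lambda>n. T \<le> ?t n"] by (simp add: N_def)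
    note bound = bound[OF this]
    have "real N powr p \<le> real N powr real (Suc P)"
      using K p by (intro powr_mono) auto
    also have "\<dots> = (1 + real K) ^ Suc P"
      using K by (subst powr_realpow) auto
    also have "\<dots> \<le> 2 ^ Suc P * (1 + real K ^ Suc P)"
    proof (cases "K = 0")
      case False
      then have "(1 + real K) ^ Suc P \<le> (2 * real K) ^ Suc P" by (intro power_mono) auto
      also have "\<dots> \<le> 2 ^ Suc P * (1 + real K ^ Suc P)" by (simp add: power_mult_distrib distrib_left)
      finally show ?thesis .
    next
      case True
      have "(1 :: real) \<le> 2 ^ Suc P" by (rule one_le_power) simp
      with True show ?thesis by simp
    qed
    finally have "enat_powr (num_steps f g h X0 T w) p \<le> ennreal (2 ^ Suc P * (1 + real K ^ Suc P))"
      by (simp add: N enat_powr_def ennreal_leI del: power_Suc)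
    also have "\<dots> = ennreal (2 ^ Suc P) * (1 + ennreal (real K ^ Suc P))"
      by (simp add: ennreal_mult ennreal_plus del: power_Suc)
    also have "\<dots> \<le> ennreal (2 ^ Suc P) * (1 + ennreal ?C * ?G)"
      by (intro mult_left_mono add_left_mono bound) auto
    finally show ?thesis .
  next
    case False
    have "ennreal ?C * ?G = \<infinity>"
    proof (rule ccontr)
      assume "ennreal ?C * ?G \<noteq> \<infinity>"
      then obtain r where r: "0 \<le> r" "ennreal ?C * ?G = ennreal r"
        by (cases "ennreal ?C * ?G") auto
      obtain K where K: "r < real K" using reals_Archimedean2 by blast
      have "ennreal (real K ^ Suc P) \<le> ennreal r"
        using bound[of K] False r by (simp add: not_le)
      then have "real K ^ Suc P \<le> r" using r by simp
      moreover have "real K ^ 1 \<le> real K ^ Suc P"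
        using K r by (intro power_increasing) auto
      ultimately show False using K by simp
    qed
    then show ?thesis by (simp add: ennreal_mult_top)
  qed
qed

lemma measurable_num_steps:
  assumes "\<And>n. (\<lambda>\<omega>. em_time f g h X0 (w \<omega>) n) \<in> borel_measurable M"
  shows "(\<lambda>\<omega>. num_steps f g h X0 T (w \<omega>)) \<in> M \<rightarrow>\<^sub>M count_space UNIV"
proof -
  note [measurable] = assms
  have "(\<lambda>\<omega>. LEAST n. T \<le> em_time f g h X0 (w \<omega>) n) \<in> M \<rightarrow>\<^sub>M count_space UNIV"
    by measurable
  then have "(\<lambda>\<omega>. enat (LEAST n. T \<le> em_time f g h X0 (w \<omega>) n)) \<in> M \<rightarrow>\<^sub>M count_space UNIV"
    by (rule measurable_compose) simp
  moreover have "{\<omega> \<in> space M. \<exists>n. T \<le> em_time f g h X0 (w \<omega>) n} \<in> sets M"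
    by measurable
  ultimately show ?thesis
    unfolding num_steps_def by (intro measurable_If) simp_all
qed

text \<open>
  The two preimages of a set differ by subsets of null sets, and these are measurable in the
  completion.
\<close>

lemma measurable_completion_cong_AE:
  assumes f: "f \<in> M \<rightarrow>\<^sub>M N" and eq: "AE \<omega> in M. f \<omega> = g \<omega>" and g: "g \<in> space M \<rightarrow> space N"
  shows "g \<in> completion M \<rightarrow>\<^sub>M N"
proof (rule measurableI)
  fix A assume A: "A \<in> sets N"
  have [measurable]: "Measurable.pred (completion M) (\<lambda>\<omega>. f \<omega> \<in> A)"
    using measurable_sets[OF measurable_completion[OF f] A] by (simp add: pred_def vimage_def Int_def conj_commute)
  have [measurable]: "Measurable.pred (completion M) (\<lambda>\<omega>. f \<omega> \<in> A \<and> g \<omega> \<notin> A)"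
    "Measurable.pred (completion M) (\<lambda>\<omega>. f \<omega> \<notin> A \<and> g \<omega> \<in> A)"
    by (rule sets_completion_AE, use eq in eventually_elim, simp)+
  have "Measurable.pred (completion M) (\<lambda>\<omega>. (f \<omega> \<in> A \<and> \<not> (f \<omega> \<in> A \<and> g \<omega> \<notin> A)) \<or> (f \<omega> \<notin> A \<and> g \<omega> \<in> A))"
    by measurable
  then have "{\<omega> \<in> space (completion M). (f \<omega> \<in> A \<and> \<not> (f \<omega> \<in> A \<and> g \<omega> \<notin> A)) \<or> (f \<omega> \<notin> A \<and> g \<omega> \<in> A)} \<in> sets (completion M)"
    by (simp add: pred_def)
  moreover have "{\<omega> \<in> space (completion M). (f \<omega> \<in> A \<and> \<not> (f \<omega> \<in> A \<and> g \<omega> \<notin> A)) \<or> (f \<omega> \<notin> A \<and> g \<omega> \<in> A)} = g -` A \<inter> space (completion M)"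
    by auto
  ultimately show "g -` A \<inter> space (completion M) \<in> sets (completion M)" by simp
qed (use g in auto)

lemma locally_lipschitz_coeffs_continuous:
  fixes f :: "real ^ 'm \<Rightarrow> real ^ 'm" and g :: "real ^ 'm \<Rightarrow> real ^ 'd ^ 'm"
  assumes "locally_lipschitz_coeffs f g"
  shows "continuous_on UNIV f" "continuous_on UNIV g"
proof -
  have cont: "continuous_on UNIV \<phi>"
    if \<phi>: "\<And>R. R > 0 \<Longrightarrow> \<exists>C. \<forall>x y. norm x \<le> R \<longrightarrow> norm y \<le> R \<longrightarrow> norm (\<phi> x - \<phi> y) \<le> C * norm (x - y)"
    for \<phi> :: "'c :: real_normed_vector \<Rightarrow> 'e :: real_normed_vector"
  proof -
    have "continuous_on (ball 0 R) \<phi>" if R: "R > 0" for R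
    proof -
      obtain C where C: "\<And>x y. norm x \<le> R \<Longrightarrow> norm y \<le> R \<Longrightarrow> norm (\<phi> x - \<phi> y) \<le> C * norm (x - y)"
        using \<phi>[OF R] by blast
      have "\<bar>C\<bar>-lipschitz_on (ball 0 R) \<phi>"
      proof (rule lipschitz_onI)
        fix x y :: 'c assume "x \<in> ball 0 R" "y \<in> ball 0 R"
        then have "norm (\<phi> x - \<phi> y) \<le> C * norm (x - y)" by (intro C) auto
        also have "\<dots> \<le> \<bar>C\<bar> * norm (x - y)" by (intro mult_right_mono) auto
        finally show "dist (\<phi> x) (\<phi> y) \<le> \<bar>C\<bar> * dist x y" by (simp add: dist_norm)
      qed simp
      then show ?thesis by (rule lipschitz_on_continuous_on)
    qed
    then have "isCont \<phi> x" for x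
      by (rule continuous_on_interior[of "ball 0 (norm x + 1)"]) (auto simp: add_nonneg_pos)
    then show ?thesis by (simp add: continuous_at_imp_continuous_on)
  qed
  have lip: "\<exists>C. \<forall>x y. norm x \<le> R \<longrightarrow> norm y \<le> R \<longrightarrow>
      norm (f x - f y) \<le> C * norm (x - y) \<and> norm (g x - g y) \<le> C * norm (x - y)" if "R > 0" for R
  proof -
    obtain C where C: "\<And>x y. norm x \<le> R \<Longrightarrow> norm y \<le> R \<Longrightarrow>
        norm (f x - f y) + norm (g x - g y) \<le> C * norm (x - y)"
      using assms \<open>R > 0\<close> unfolding locally_lipschitz_coeffs_def by blast
    show ?thesis
    proof (intro exI allI impI)
      fix x y :: "real ^ 'm" assume "norm x \<le> R" "norm y \<le> R"
      from C[OF this] norm_ge_zero[of "f x - f y"] norm_ge_zero[of "g x - g y"]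
      show "norm (f x - f y) \<le> C * norm (x - y) \<and> norm (g x - g y) \<le> C * norm (x - y)"
        by linarith
    qed
  qed
  show "continuous_on UNIV f" by (rule cont) (use lip in blast)
  show "continuous_on UNIV g" by (rule cont) (use lip in blast)
qed

lemma (in adaptive_scheme) num_steps_moment_finite:
  assumes T: "0 < T" and p: "0 < p" "p \<le> real (Suc P)" and D_nonneg: "0 \<le> D"
    and D: "\<And>x. (1 / h x) ^ Suc P \<le> D * energy (k + 2) x"
  shows "(\<integral>\<^sup>+\<omega>. enat_powr (num_steps f g h X0 T (\<lambda>r. W r \<omega>)) p \<partial>M) < \<infinity>"
proof -
  let ?C = "2 * (2 * T) ^ P * D"
  let ?G = "\<lambda>n \<omega>. if t (Suc n) \<omega> < T then ennreal (h (x n \<omega>) * energy (k + 2) (x n \<omega>)) else 0"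
  have "(\<integral>\<^sup>+\<omega>. enat_powr (num_steps f g h X0 T (\<lambda>r. W r \<omega>)) p \<partial>M)
      \<le> (\<integral>\<^sup>+\<omega>. ennreal (2 ^ Suc P) * (1 + ennreal ?C * (\<Sum>n. ?G n \<omega>)) \<partial>M)"
    unfolding t_def x_def by (rule nn_integral_mono) (rule enat_powr_num_steps_le[OF h_pos T D p D_nonneg])
  also have "\<dots> = ennreal (2 ^ Suc P) * (1 + ennreal ?C * (\<Sum>n. \<integral>\<^sup>+\<omega>. ?G n \<omega> \<partial>M))"
    by (simp add: nn_integral_cmult nn_integral_add nn_integral_suminf emeasure_space_1 del: power_Suc)
  also have "\<dots> < \<infinity>"
    using summable_weighted_moments[OF T, of k] by (simp add: ennreal_mult_less_top del: power_Suc)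
  finally show ?thesis .
qed

text \<open>
  The added 2 in the exponent matches the form \<open>k + 2\<close> required by the symmetric second-order
  estimates.
\<close>

lemma power_inverse_timestep_le:
  fixes h :: "real ^ 'm \<Rightarrow> real"
  assumes h: "\<And>x. 0 < h x" and lower: "\<And>x. inverse (\<xi> * norm x powr q + \<zeta>) \<le> h x"
    and pos: "0 < \<xi>" "0 < \<zeta>" "0 < q" and Q: "q \<le> real Q"
  shows "(1 / h x) ^ P \<le> (\<xi> + \<zeta>) ^ P * energy (P * Q + 2) x"
proof -
  let ?S = "1 + (norm x)\<^sup>2"
  have S: "1 \<le> ?S" by simp
  have "norm x \<le> ?S"
  proof (cases "norm x \<le> 1")
    case False
    then have "norm x ^ 1 \<le> norm x ^ 2" by (intro power_increasing) auto
    then show ?thesis by simp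
  qed (use zero_le_power2[of "norm x"] in linarith)
  then have "norm x powr q \<le> ?S powr q"
    using pos by (intro powr_mono2) auto
  also have "\<dots> \<le> ?S powr real Q"
    using Q S by (intro powr_mono) auto
  also have "\<dots> = ?S ^ Q"
    using S by (intro powr_realpow) linarith
  finally have x: "norm x powr q \<le> ?S ^ Q" .
  have a: "0 < \<xi> * norm x powr q + \<zeta>"
    using pos by (intro add_nonneg_pos) auto
  have "1 / h x \<le> \<xi> * norm x powr q + \<zeta>"
    using le_imp_inverse_le[OF lower[of x]] a by (simp add: inverse_eq_divide)
  also have "\<dots> \<le> \<xi> * ?S ^ Q + \<zeta> * ?S ^ Q"
    using x pos S by (intro add_mono mult_left_mono) (auto simp: mult_le_cancel_left1 one_le_power)
  finally have "1 / h x \<le> (\<xi> + \<zeta>) * ?S ^ Q"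
    by (simp add: distrib_right)
  then have "(1 / h x) ^ P \<le> ((\<xi> + \<zeta>) * ?S ^ Q) ^ P"
    using h[of x] by (intro power_mono) auto
  also have "\<dots> = (\<xi> + \<zeta>) ^ P * ?S ^ (P * Q)"
    by (simp add: power_mult_distrib power_mult[symmetric] mult.commute)
  also have "\<dots> \<le> (\<xi> + \<zeta>) ^ P * ?S ^ (P * Q + 2)"
    using pos S by (intro mult_left_mono power_increasing) auto
  finally show ?thesis by (simp add: energy_def)
qed

theorem lemma2:
  fixes M :: "'a measure"
    and F :: "real \<Rightarrow> 'a measure"
    and W :: "real \<Rightarrow> 'a \<Rightarrow> real ^ 'd"
    and f :: "real ^ 'm \<Rightarrow> real ^ 'm"
    and g :: "real ^ 'm \<Rightarrow> real ^ 'd ^ 'm"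
    and h :: "real ^ 'm \<Rightarrow> real"
    and X0 :: "real ^ 'm"
    and T \<alpha> \<beta> \<alpha>' \<beta>' \<xi> \<zeta> q p :: real
  assumes "prob_space M"
    and "normal_filtration M F"
    and "brownian_motion M F W"
    and "T > 0"
    and "locally_lipschitz_coeffs f g"
    and "\<alpha> \<ge> 0" and "\<beta> \<ge> 0"
    and "\<And>x. x \<bullet> f x \<le> \<alpha> * (norm x)\<^sup>2 + \<beta>"
    and "\<And>x. (norm (g x))\<^sup>2 \<le> \<alpha> * (norm x)\<^sup>2 + \<beta>"
    and "continuous_on UNIV h"
    and "\<And>x. h x > 0"
    and "\<alpha>' > 0" and "\<beta>' > 0" and "\<xi> > 0" and "\<zeta> > 0" and "q > 0"
    and "\<And>x. x \<bullet> f x + 1 / 2 * h x * (norm (f x))\<^sup>2 \<le> \<alpha>' * (norm x)\<^sup>2 + \<beta>'"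
    and "\<And>x. h x \<ge> inverse (\<xi> * norm x powr q + \<zeta>)"
    and "p > 0"
  shows "(\<lambda>\<omega>. num_steps f g h X0 T (\<lambda>t. W t \<omega>)) \<in> measurable (completion M) (count_space UNIV)
    \<and> (\<integral>\<^sup>+ \<omega>. enat_powr (num_steps f g h X0 T (\<lambda>t. W t \<omega>)) p \<partial>completion M) < \<infinity>"
proof -
  note h_pos = assms(11) and step_bound = assms(17)
  obtain W' where W': "brownian_motion M F W'"
    and same: "AE \<omega> in M. \<forall>t. W' t \<omega> = W t \<omega>"
    and paths: "\<And>\<omega>. \<omega> \<in> space M \<Longrightarrow> continuous_on {0..} (\<lambda>t. W' t \<omega>)"
    using ex_continuous_modification[OF assms(1-3)] by blast
  \<comment> \<open>One constant for both growth conditions of the locale.\<close>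
  define c where "c = 2 * \<alpha>' + 2 * \<beta>' + \<alpha> + \<beta>"
  have drift: "1 + (norm (x + h x *\<^sub>R f x))\<^sup>2 \<le> (1 + (norm x)\<^sup>2) * (1 + c * h x)" for x
  proof -
    have "(norm (x + h x *\<^sub>R f x))\<^sup>2 = (norm x)\<^sup>2 + 2 * h x * (x \<bullet> f x + 1 / 2 * h x * (norm (f x))\<^sup>2)"
      unfolding power2_norm_eq_inner
      by (simp add: inner_add_left inner_add_right inner_commute algebra_simps)
    also have "\<dots> \<le> (norm x)\<^sup>2 + 2 * h x * (\<alpha>' * (norm x)\<^sup>2 + \<beta>')"
      using h_pos[of x] step_bound[of x] by (intro add_left_mono mult_left_mono) auto
    also have "\<dots> = (norm x)\<^sup>2 + h x * (2 * \<alpha>' * (norm x)\<^sup>2 + 2 * \<beta>')"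
      by (simp add: algebra_simps)
    also have "\<dots> \<le> (norm x)\<^sup>2 + h x * (c * (norm x)\<^sup>2 + c)"
      using h_pos[of x] assms(6,7,12,13)
      by (intro add_left_mono mult_left_mono add_mono mult_right_mono) (auto simp: c_def)
    finally show ?thesis by (simp add: algebra_simps)
  qed
  have diffusion: "(norm (g x))\<^sup>2 \<le> (1 + (norm x)\<^sup>2) * c" for x
  proof -
    have "\<alpha> * (norm x)\<^sup>2 + \<beta> \<le> c * (norm x)\<^sup>2 + c"
      using assms(6,7,12,13) by (intro add_mono mult_right_mono) (auto simp: c_def)
    with assms(9)[of x] show ?thesis by (simp add: algebra_simps)
  qed
  interpret prob_space M by (rule assms(1))
  interpret adaptive_scheme M F W' f g h X0 c
    by unfold_locales (use assms(2,6,7,10,12,13) W' paths h_pos drift diffusion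
        locally_lipschitz_coeffs_continuous[OF assms(5)] in \<open>auto simp: c_def\<close>)
  let ?N = "\<lambda>\<omega>. num_steps f g h X0 T (\<lambda>t. W t \<omega>)" and ?N' = "\<lambda>\<omega>. num_steps f g h X0 T (\<lambda>t. W' t \<omega>)"
  have N_eq: "AE \<omega> in M. ?N' \<omega> = ?N \<omega>"
    using same by eventually_elim simp
  have "?N' \<in> M \<rightarrow>\<^sub>M count_space UNIV"
    by (rule measurable_num_steps) (use t_measurable in \<open>simp add: t_def[abs_def]\<close>)
  then have meas: "?N \<in> completion M \<rightarrow>\<^sub>M count_space UNIV"
    by (rule measurable_completion_cong_AE[OF _ N_eq]) simp
  define P where "P = nat \<lceil>p\<rceil>"
  define Q where "Q = nat \<lceil>q\<rceil>"
  have P: "p \<le> real (Suc P)" and Q: "q \<le> real Q"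
    unfolding P_def Q_def by linarith+
  have "0 \<le> (\<xi> + \<zeta>) ^ Suc P"
    using assms(14,15) by simp
  then have "(\<integral>\<^sup>+\<omega>. enat_powr (?N' \<omega>) p \<partial>M) < \<infinity>"
    by (rule num_steps_moment_finite[OF assms(4,19) P _
          power_inverse_timestep_le[OF h_pos assms(18,14-16) Q]])
  moreover have "(\<integral>\<^sup>+\<omega>. enat_powr (?N \<omega>) p \<partial>completion M) = (\<integral>\<^sup>+\<omega>. enat_powr (?N' \<omega>) p \<partial>M)"
    unfolding nn_integral_completion by (rule nn_integral_cong_AE) (use N_eq in eventually_elim, simp)
  ultimately show ?thesis using meas by simp
qed

end
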